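(* Let $G$ be a group. If $G$ has a finite index subgroup that surjects onto a free non-abelian group, then for every $n$ and every representation $\rho : G \to \mathrm{GL}(n,\mathbb{Z})$, the pair $(G,\rho)$ does not admit the congruence subgroup property.
   Context: Given a representation $\rho : G \to \mathrm{GL}(n,\mathbb{Z})$ and an integer $m \ge 2$, the principal congruence subgroup $G[m]$ of level $m$ (with respect to $\rho$) is the kernel of the composition $G \xrightarrow{\rho} \mathrm{GL}(n,\mathbb{Z}) \to \mathrm{GL}(n,\mathbb{Z}/m)$. The pair $(G,\rho)$ admits the congruence subgroup property if every finite index subgroup of $G$ contains $G[m]$ for some $m \ge 2$. *)

theory Defs
  imports "HOL-Algebra.Coset" "Jordan_Normal_Form.Matrix"
begin

section \<open>Free groups\<close>

text \<open>The letter \<open>(x, True)\<close> stands for the generator \<open>x\<close> and \<open>(x, False)\<close> for its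
  formal inverse. The free group on \<open>X\<close> is the set of reduced words in these letters; the product
  is the reduced form of the concatenation.\<close>

type_synonym 'a letter = "'a \<times> bool"

definition inv_letter :: "'a letter \<Rightarrow> 'a letter" where
  "inv_letter a = (fst a, \<not> snd a)"

definition reduced :: "'a letter list \<Rightarrow> bool" where
  "reduced w \<longleftrightarrow> successively (\<lambda>a b. b \<noteq> inv_letter a) w"

fun cancel_cons :: "'a letter \<Rightarrow> 'a letter list \<Rightarrow> 'a letter list" where
  "cancel_cons a [] = [a]"
| "cancel_cons a (b # w) = (if b = inv_letter a then w else a # b # w)"

definition red_mult :: "'a letter list \<Rightarrow> 'a letter list \<Rightarrow> 'a letter list" where
  "red_mult u v = foldr cancel_cons u v"

definition free_group :: "'a set \<Rightarrow> 'a letter list monoid" where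
  "free_group X = \<lparr>carrier = {w. reduced w \<and> set w \<subseteq> X \<times> UNIV}, monoid.mult = red_mult, one = []\<rparr>"

text \<open>Taking the basis \<open>X\<close> inside the type of elements of \<open>F\<close> loses nothing, since a basis of \<open>F\<close>
  can always be chosen as a subset of \<open>F\<close>.\<close>

definition is_free_group :: "('a, 'b) monoid_scheme \<Rightarrow> bool" where
  "is_free_group F \<longleftrightarrow> group F \<and> (\<exists>X :: 'a set. F \<cong> free_group X)"

lemma inv_letter_inv_letter [simp]: "inv_letter (inv_letter a) = a"
  by (simp add: inv_letter_def)

lemma reduced_Nil [simp]: "reduced []"
  by (simp add: reduced_def)

lemma reduced_Cons: "reduced (a # w) \<longleftrightarrow> reduced w \<and> (w \<noteq> [] \<longrightarrow> hd w \<noteq> inv_letter a)"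
  by (cases w) (auto simp: reduced_def)

lemma reduced_cancel_cons: "reduced w \<Longrightarrow> reduced (cancel_cons a w)"
  by (cases w) (auto simp: reduced_Cons)

lemma reduced_red_mult: "reduced v \<Longrightarrow> reduced (red_mult u v)"
  by (induction u) (auto simp: red_mult_def reduced_cancel_cons)

lemma set_cancel_cons: "set (cancel_cons a w) \<subseteq> insert a (set w)"
  by (cases w) auto

lemma set_red_mult: "set (red_mult u v) \<subseteq> set u \<union> set v"
proof (induction u)
  case (Cons a u)
  then show ?case using set_cancel_cons[of a "red_mult u v"] by (auto simp: red_mult_def)
qed (simp add: red_mult_def)

lemma cancel_cons_inverse: "reduced w \<Longrightarrow> cancel_cons a (cancel_cons (inv_letter a) w) = w"
  by (cases w rule: remdups_adj.cases) (auto simp: reduced_Cons)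

lemma red_mult_cancel_cons:
  "reduced w \<Longrightarrow> red_mult (cancel_cons a x) w = cancel_cons a (red_mult x w)"
  by (cases x) (auto simp: red_mult_def cancel_cons_inverse[unfolded red_mult_def]
      reduced_red_mult[unfolded red_mult_def])

lemma red_mult_assoc:
  "reduced w \<Longrightarrow> red_mult (red_mult u v) w = red_mult u (red_mult v w)"
proof (induction u)
  case (Cons a u)
  have "red_mult (red_mult (a # u) v) w = red_mult (cancel_cons a (red_mult u v)) w"
    by (simp add: red_mult_def)
  also have "\<dots> = cancel_cons a (red_mult u (red_mult v w))"
    using Cons by (simp add: red_mult_cancel_cons)
  finally show ?case by (simp add: red_mult_def)
qed (simp add: red_mult_def)

lemma red_mult_Nil: "reduced u \<Longrightarrow> red_mult u [] = u"
proof (induction u)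
  case (Cons a u)
  then show ?case by (cases u) (auto simp: red_mult_def reduced_Cons)
qed (simp add: red_mult_def)

lemma red_mult_inverse: "reduced u \<Longrightarrow> \<exists>v. reduced v \<and> set v \<subseteq> inv_letter ` set u \<and> red_mult v u = []"
proof (induction u)
  case Nil
  show ?case by (rule exI[of _ "[]"]) (simp add: red_mult_def)
next
  case (Cons a u)
  then obtain v where v: "reduced v" "set v \<subseteq> inv_letter ` set u" "red_mult v u = []"
    by (auto simp: reduced_Cons)
  let ?v = "red_mult v [inv_letter a]"
  have "red_mult ?v (a # u) = red_mult v (red_mult [inv_letter a] (a # u))"
    using Cons.prems by (rule red_mult_assoc)
  also have "red_mult [inv_letter a] (a # u) = u"
    by (simp add: red_mult_def)
  finally have "red_mult ?v (a # u) = []" using v by simp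
  moreover have "reduced ?v" by (simp add: reduced_red_mult reduced_Cons)
  moreover have "set ?v \<subseteq> inv_letter ` set (a # u)"
    using set_red_mult[of v "[inv_letter a]"] v by auto
  ultimately show ?case by blast
qed

lemma group_free_group: "group (free_group X)"
proof (rule groupI)
  fix x assume "x \<in> carrier (free_group X)"
  then have x: "reduced x" "set x \<subseteq> X \<times> UNIV" by (auto simp: free_group_def)
  obtain v where v: "reduced v" "set v \<subseteq> inv_letter ` set x" "red_mult v x = []"
    using red_mult_inverse[OF x(1)] by blast
  have "set v \<subseteq> X \<times> UNIV" using v(2) x(2) by (fastforce simp: inv_letter_def)
  then show "\<exists>y\<in>carrier (free_group X). y \<otimes>\<^bsub>free_group X\<^esub> x = \<one>\<^bsub>free_group X\<^esub>"
    using v by (auto simp: free_group_def)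
next
  fix x y assume "x \<in> carrier (free_group X)" "y \<in> carrier (free_group X)"
  then show "x \<otimes>\<^bsub>free_group X\<^esub> y \<in> carrier (free_group X)"
    using set_red_mult[of x y] by (auto simp: free_group_def reduced_red_mult)
next
  fix x assume "x \<in> carrier (free_group X)"
  then show "\<one>\<^bsub>free_group X\<^esub> \<otimes>\<^bsub>free_group X\<^esub> x = x"
    by (simp add: free_group_def red_mult_def)
qed (auto simp: free_group_def red_mult_assoc)


section \<open>Integral representations and congruence subgroups\<close>

definition GL_int :: "nat \<Rightarrow> int mat monoid" where
  "GL_int n = units_of (ring_mat TYPE(int) n ())"

text \<open>The elements of \<open>\<int>/m\<close> are represented by \<open>0, \<dots>, m - 1\<close>.\<close>

definition mat_mod :: "nat \<Rightarrow> int mat \<Rightarrow> int mat" where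
  "mat_mod m = map_mat (\<lambda>x. x mod int m)"

definition monoid_mat_mod :: "nat \<Rightarrow> nat \<Rightarrow> int mat monoid" where
  "monoid_mat_mod n m =
    \<lparr>carrier = {A \<in> carrier_mat n n. elements_mat A \<subseteq> {0..<int m}},
     monoid.mult = (\<lambda>A B. mat_mod m (A * B)),
     one = mat_mod m (1\<^sub>m n)\<rparr>"

definition GL_mod :: "nat \<Rightarrow> nat \<Rightarrow> int mat monoid" where
  "GL_mod n m = units_of (monoid_mat_mod n m)"

definition principal_congruence_subgroup ::
    "('g, 'c) monoid_scheme \<Rightarrow> nat \<Rightarrow> ('g \<Rightarrow> int mat) \<Rightarrow> nat \<Rightarrow> 'g set" where
  "principal_congruence_subgroup G n \<rho> m = kernel G (GL_mod n m) (mat_mod m \<circ> \<rho>)"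

definition finite_index_subgroup :: "'g set \<Rightarrow> ('g, 'c) monoid_scheme \<Rightarrow> bool" where
  "finite_index_subgroup H G \<longleftrightarrow> subgroup H G \<and> finite (rcosets\<^bsub>G\<^esub> H)"

definition congruence_subgroup_property ::
    "('g, 'c) monoid_scheme \<Rightarrow> nat \<Rightarrow> ('g \<Rightarrow> int mat) \<Rightarrow> bool" where
  "congruence_subgroup_property G n \<rho> \<longleftrightarrow>
    (\<forall>H. finite_index_subgroup H G \<longrightarrow> (\<exists>m\<ge>2. principal_congruence_subgroup G n \<rho> m \<subseteq> H))"

lemma group_GL_int: "group (GL_int n)"
proof -
  interpret ring "ring_mat TYPE(int) n ()" by (rule ring_mat)
  show ?thesis unfolding GL_int_def by (rule units_group)
qed

lemma mat_mod_carrier [simp]: "mat_mod m A \<in> carrier_mat r c \<longleftrightarrow> A \<in> carrier_mat r c"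
  by (simp add: mat_mod_def)

lemma mat_mod_mult_aux:
  assumes "A \<in> carrier_mat n n" "A' \<in> carrier_mat n n" "B \<in> carrier_mat n n" "B' \<in> carrier_mat n n"
    and "mat_mod m A = mat_mod m A'" "mat_mod m B = mat_mod m B'"
  shows "mat_mod m (A * B) = mat_mod m (A' * B')"
proof (rule eq_matI)
  fix i j assume "i < dim_row (mat_mod m (A' * B'))" "j < dim_col (mat_mod m (A' * B'))"
  then have ij: "i < n" "j < n" using assms by (auto simp: mat_mod_def)
  have *: "C $$ (i, j) mod int m = C' $$ (i, j) mod int m"
    if "C \<in> carrier_mat n n" "C' \<in> carrier_mat n n" "mat_mod m C = mat_mod m C'" "i < n" "j < n"
    for C C' i j
    using that(1,2,4,5) arg_cong[OF that(3), of "\<lambda>M. M $$ (i, j)"] by (simp add: mat_mod_def)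
  have "(\<Sum>k = 0..<n. A $$ (i, k) * B $$ (k, j)) mod int m
      = (\<Sum>k = 0..<n. A $$ (i, k) * B $$ (k, j) mod int m) mod int m"
    by (rule mod_sum_eq[symmetric])
  also have "(\<Sum>k = 0..<n. A $$ (i, k) * B $$ (k, j) mod int m)
      = (\<Sum>k = 0..<n. A' $$ (i, k) * B' $$ (k, j) mod int m)"
    using ij *[OF assms(1,2,5)] *[OF assms(3,4,6)]
    by (intro sum.cong refl mod_mult_cong) auto
  also have "\<dots> mod int m = (\<Sum>k = 0..<n. A' $$ (i, k) * B' $$ (k, j)) mod int m"
    by (rule mod_sum_eq)
  finally show "mat_mod m (A * B) $$ (i, j) = mat_mod m (A' * B') $$ (i, j)"
    using ij assms(1-4) by (simp add: mat_mod_def scalar_prod_def)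
qed (use assms in \<open>auto simp: mat_mod_def\<close>)

lemma mat_mod_idem [simp]: "mat_mod m (mat_mod m A) = mat_mod m A"
  by (rule eq_matI) (auto simp: mat_mod_def)

lemma mat_mod_eq:
  assumes "elements_mat A \<subseteq> {0..<int m}"
  shows "mat_mod m A = A"
proof (rule eq_matI)
  fix i j assume ij: "i < dim_row A" "j < dim_col A"
  then have "A $$ (i, j) \<in> elements_mat A" by auto
  then have "A $$ (i, j) \<in> {0..<int m}" using assms by blast
  then show "mat_mod m A $$ (i, j) = A $$ (i, j)" using ij by (simp add: mat_mod_def)
qed (auto simp: mat_mod_def)

lemma mat_mod_closed:
  "m > 0 \<Longrightarrow> A \<in> carrier_mat n n \<Longrightarrow> mat_mod m A \<in> carrier (monoid_mat_mod n m)"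
  by (auto simp: monoid_mat_mod_def mat_mod_def elements_mat_def)

lemma monoid_monoid_mat_mod:
  assumes m: "m > 0"
  shows "monoid (monoid_mat_mod n m)"
proof (rule monoidI)
  fix A B C
  assume "A \<in> carrier (monoid_mat_mod n m)" "B \<in> carrier (monoid_mat_mod n m)"
    "C \<in> carrier (monoid_mat_mod n m)"
  then have c: "A \<in> carrier_mat n n" "B \<in> carrier_mat n n" "C \<in> carrier_mat n n"
    by (auto simp: monoid_mat_mod_def)
  have "mat_mod m (mat_mod m (A * B) * C) = mat_mod m (A * B * C)"
    using c by (intro mat_mod_mult_aux[where n = n]) auto
  also have "\<dots> = mat_mod m (A * mat_mod m (B * C))"
    unfolding assoc_mult_mat[OF c] using c by (intro mat_mod_mult_aux[where n = n]) auto
  finally show "A \<otimes>\<^bsub>monoid_mat_mod n m\<^esub> B \<otimes>\<^bsub>monoid_mat_mod n m\<^esub> C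
      = A \<otimes>\<^bsub>monoid_mat_mod n m\<^esub> (B \<otimes>\<^bsub>monoid_mat_mod n m\<^esub> C)"
    by (simp add: monoid_mat_mod_def)
next
  fix A B
  assume "A \<in> carrier (monoid_mat_mod n m)" "B \<in> carrier (monoid_mat_mod n m)"
  then have "mat_mod m (A * B) \<in> carrier (monoid_mat_mod n m)"
    using m by (intro mat_mod_closed) (auto simp: monoid_mat_mod_def)
  then show "A \<otimes>\<^bsub>monoid_mat_mod n m\<^esub> B \<in> carrier (monoid_mat_mod n m)"
    by (simp add: monoid_mat_mod_def)
next
  have "mat_mod m (1\<^sub>m n) \<in> carrier (monoid_mat_mod n m)"
    using m by (intro mat_mod_closed) auto
  then show "\<one>\<^bsub>monoid_mat_mod n m\<^esub> \<in> carrier (monoid_mat_mod n m)"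
    by (simp add: monoid_mat_mod_def)
next
  fix A assume "A \<in> carrier (monoid_mat_mod n m)"
  then have A: "A \<in> carrier_mat n n" "mat_mod m A = A"
    by (auto simp: monoid_mat_mod_def mat_mod_eq)
  have "mat_mod m (mat_mod m (1\<^sub>m n) * A) = mat_mod m (1\<^sub>m n * A)"
    using A by (intro mat_mod_mult_aux[where n = n]) auto
  then show "\<one>\<^bsub>monoid_mat_mod n m\<^esub> \<otimes>\<^bsub>monoid_mat_mod n m\<^esub> A = A"
    using A by (simp add: monoid_mat_mod_def)
  have "mat_mod m (A * mat_mod m (1\<^sub>m n)) = mat_mod m (A * 1\<^sub>m n)"
    using A by (intro mat_mod_mult_aux[where n = n]) auto
  then show "A \<otimes>\<^bsub>monoid_mat_mod n m\<^esub> \<one>\<^bsub>monoid_mat_mod n m\<^esub> = A"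
    using A by (simp add: monoid_mat_mod_def)
qed

lemma group_GL_mod: "m > 0 \<Longrightarrow> group (GL_mod n m)"
  unfolding GL_mod_def by (rule monoid.units_group[OF monoid_monoid_mat_mod])

lemma mat_mod_hom:
  assumes m: "m > 0"
  shows "mat_mod m \<in> hom (GL_int n) (GL_mod n m)"
proof (rule homI)
  fix A assume "A \<in> carrier (GL_int n)"
  then obtain B where AB: "A \<in> carrier_mat n n" "B \<in> carrier_mat n n" "A * B = 1\<^sub>m n" "B * A = 1\<^sub>m n"
    by (auto simp: GL_int_def units_of_carrier Units_def ring_mat_simps)
  have "mat_mod m (mat_mod m A * mat_mod m B) = mat_mod m (1\<^sub>m n)"
    unfolding AB(3)[symmetric] using AB by (intro mat_mod_mult_aux[where n = n]) auto
  moreover have "mat_mod m (mat_mod m B * mat_mod m A) = mat_mod m (1\<^sub>m n)"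
    unfolding AB(4)[symmetric] using AB by (intro mat_mod_mult_aux[where n = n]) auto
  ultimately have "mat_mod m A \<in> Units (monoid_mat_mod n m)"
    using mat_mod_closed[OF m AB(1)] mat_mod_closed[OF m AB(2)]
    unfolding Units_def by (auto simp: monoid_mat_mod_def intro!: exI[of _ "mat_mod m B"])
  then show "mat_mod m A \<in> carrier (GL_mod n m)"
    by (simp add: GL_mod_def units_of_carrier)
next
  fix A B assume "A \<in> carrier (GL_int n)" "B \<in> carrier (GL_int n)"
  then have AB: "A \<in> carrier_mat n n" "B \<in> carrier_mat n n"
    by (auto simp: GL_int_def units_of_carrier Units_def ring_mat_simps)
  have "mat_mod m (A * B) = mat_mod m (mat_mod m A * mat_mod m B)"
    using AB by (intro mat_mod_mult_aux[where n = n]) auto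
  then show "mat_mod m (A \<otimes>\<^bsub>GL_int n\<^esub> B) = mat_mod m A \<otimes>\<^bsub>GL_mod n m\<^esub> mat_mod m B"
    by (simp add: GL_int_def GL_mod_def units_of_mult ring_mat_simps monoid_mat_mod_def)
qed

end

theory Submission
  imports Defs "HOL-Algebra.Sylow" "HOL-Algebra.Sym_Groups" "HOL-Algebra.Group_Action"
    "HOL-Algebra.Multiplicative_Group" "HOL-Number_Theory.Cong"
begin

text \<open>Since \<open>F\<close> is free of rank at least two, \<open>H\<close> maps onto every symmetric group \<open>S\<^sub>k\<close>, and the
  kernel of \<open>f : H \<rightarrow> S\<^sub>k\<close> has finite index in \<open>G\<close>. Suppose it contains a congruence subgroup, and
  write \<open>H[m]\<close> for \<open>H \<inter> G[m]\<close>. As \<open>(1 + aX)(1 + bY)\<close> and \<open>(1 + bY)(1 + aX)\<close> agree modulo \<open>ab\<close>, the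
  commutator of \<open>H[a]\<close> and \<open>H[b]\<close> lies in \<open>H[ab]\<close>; for \<open>k \<ge> 5\<close> two commuting normal subgroups of \<open>S\<^sub>k\<close> cannot both
  be nontrivial, so the least \<open>m\<close> with \<open>H[m]\<close> in the kernel is a prime \<open>p\<close>. Then \<open>S\<^sub>k\<close> is a section of
  \<open>GL(n, p)\<close>. If \<open>k\<close> is large, \<open>S\<^sub>k\<close> contains a nonabelian \<open>r\<close>-group for a prime \<open>r \<noteq> p\<close> with \<open>r > n\<^sup>2\<close>
  (two candidates for \<open>r\<close> suffice, as \<open>p\<close> can exclude only one), and by Sylow so does \<open>GL(n, p)\<close>.

  This is impossible. A nonabelian \<open>r\<close>-group contains \<open>x, y\<close> whose commutator \<open>z \<noteq> 1\<close> commutes with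
  both, so that \<open>y x y\<inverse> = z x\<close>. By counting, \<open>x\<close> satisfies a nontrivial polynomial relation of degree
  at most \<open>n\<^sup>2 < r\<close> over the prime field. Conjugating by \<open>y\<close> and eliminating turns it into
  \<open>(z - 1)\<^sup>J = 0\<close>, because \<open>z - 1\<close> is a multiple of \<open>z\<^sup>d - 1\<close> for \<open>d\<close> prime to \<open>r\<close>; but a unipotent
  element of order prime to \<open>p\<close> is trivial.\<close>

section \<open>Central commutators in finite rings\<close>

context ring
begin

text \<open>The cofactor is the geometric sum 1 + a + ... + a^(e-1), which as a polynomial in
  \<open>a\<close> commutes with whatever \<open>a\<close> commutes with. The ring is
  noncommutative, so this clause is what lets the cofactor enter a coefficient later.\<close>

lemma geometric_factor:
  assumes a: "a \<in> carrier R"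
  shows "\<exists>w \<in> carrier R. a [^] (e::nat) \<ominus> \<one> = (a \<ominus> \<one>) \<otimes> w \<and>
    (\<forall>b \<in> carrier R. a \<otimes> b = b \<otimes> a \<longrightarrow> w \<otimes> b = b \<otimes> w)"
proof (induction e)
  case 0
  show ?case using a by (intro bexI[of _ \<zero>]) (auto simp: a_minus_def r_neg)
next
  case (Suc e)
  then obtain w where w: "w \<in> carrier R" "a [^] e \<ominus> \<one> = (a \<ominus> \<one>) \<otimes> w"
    "\<And>b. b \<in> carrier R \<Longrightarrow> a \<otimes> b = b \<otimes> a \<Longrightarrow> w \<otimes> b = b \<otimes> w" by blast
  have "a [^] Suc e \<ominus> \<one> = (a [^] e \<ominus> \<one>) \<otimes> a \<oplus> (a \<ominus> \<one>)"
    using a by (simp add: a_minus_def l_distr) (simp add: l_minus a_assoc r_neg1 r_neg2 l_neg)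
  also have "\<dots> = (a \<ominus> \<one>) \<otimes> (w \<otimes> a \<oplus> \<one>)"
    using a w by (simp add: m_assoc r_distr)
  finally have *: "a [^] Suc e \<ominus> \<one> = (a \<ominus> \<one>) \<otimes> (w \<otimes> a \<oplus> \<one>)" .
  have "(w \<otimes> a \<oplus> \<one>) \<otimes> b = b \<otimes> (w \<otimes> a \<oplus> \<one>)" if b: "b \<in> carrier R" "a \<otimes> b = b \<otimes> a" for b
  proof -
    have "w \<otimes> a \<otimes> b = w \<otimes> b \<otimes> a" using a b w(1) by (simp add: m_assoc)
    also have "\<dots> = b \<otimes> (w \<otimes> a)" using a b w(1) w(3)[OF b] by (simp add: m_assoc)
    finally show ?thesis using a b w(1) by (simp add: l_distr r_distr)
  qed
  then show ?case using * a w(1) by (intro bexI[of _ "w \<otimes> a \<oplus> \<one>"]) auto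
qed

lemma Units_annihilate:
  assumes "v \<in> Units R" "s \<in> carrier R" "s \<otimes> v = \<zero>"
  shows "s = \<zero>"
proof -
  have "s = s \<otimes> v \<otimes> inv v" using assms(1,2) by (simp add: m_assoc Units_closed)
  then show ?thesis using assms by simp
qed

text \<open>For invertible \<open>y\<close> this reads y x^j y^-1 = (z x)^j = z^j x^j; the form
  without inverses is proved by moving \<open>y\<close> past one factor \<open>x\<close> at a
  time.\<close>

lemma twisted_power:
  assumes x: "x \<in> carrier R" and y: "y \<in> carrier R" and z: "z \<in> carrier R"
    and zx: "z \<otimes> x = x \<otimes> z" and yx: "y \<otimes> x = z \<otimes> x \<otimes> y"
  shows "y \<otimes> x [^] (j::nat) = z [^] j \<otimes> x [^] j \<otimes> y"
proof (induction j)
  case 0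
  show ?case using y by simp
next
  case (Suc j)
  have "y \<otimes> x [^] Suc j = (y \<otimes> x [^] j) \<otimes> x" using x y by (simp add: m_assoc)
  also have "\<dots> = z [^] j \<otimes> x [^] j \<otimes> (y \<otimes> x)" unfolding Suc using x y z by (simp add: m_assoc)
  also have "\<dots> = z [^] j \<otimes> (x [^] j \<otimes> z) \<otimes> x \<otimes> y" unfolding yx using x y z by (simp add: m_assoc)
  also have "x [^] j \<otimes> z = z \<otimes> x [^] j" using group_commutes_pow[of x z j] x z zx by simp
  finally show ?case using x y z by (simp add: m_assoc)
qed

text \<open>Conjugation by \<open>y\<close> replaces \<open>x\<close> by \<open>z \<otimes> x\<close>; subtracting the conjugated relation removes
  the constant term, after which \<open>x\<close> can be cancelled.\<close>

lemma twisted_relation: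
  assumes x: "x \<in> Units R" and y: "y \<in> Units R" and z: "z \<in> carrier R"
    and zx: "z \<otimes> x = x \<otimes> z" and zy: "z \<otimes> y = y \<otimes> z" and yx: "y \<otimes> x = z \<otimes> x \<otimes> y"
    and W: "\<And>d. 1 \<le> d \<Longrightarrow> d \<le> n \<Longrightarrow> w d \<in> carrier R \<and> (z [^] (d::nat) \<ominus> \<one>) \<otimes> w d = z \<ominus> \<one> \<and>
      w d \<otimes> x = x \<otimes> w d \<and> w d \<otimes> y = y \<otimes> w d"
    and c: "\<And>j. j \<le> n \<Longrightarrow> c j \<in> carrier R \<and> c j \<otimes> x = x \<otimes> c j \<and> c j \<otimes> y = y \<otimes> c j"
    and rel: "(\<Oplus>j\<in>{..n}. c j \<otimes> x [^] j) = \<zero>"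
  shows "c n \<otimes> (z \<ominus> \<one>) [^] n = \<zero>"
  using W c rel
proof (induction n arbitrary: c)
  case 0
  then show ?case by simp
next
  case (Suc n)
  have xc: "x \<in> carrier R" and yc: "y \<in> carrier R" using x y by auto
  have cc: "c j \<in> carrier R" if "j \<le> Suc n" for j using Suc.prems(2) that by blast
  have zjc: "z [^] (j::nat) \<otimes> x = x \<otimes> z [^] j" "z [^] (j::nat) \<otimes> y = y \<otimes> z [^] j" for j
    using group_commutes_pow z xc yc zx zy by auto
  \<comment> \<open>Moving \<open>y\<close> from the left of the relation to its right turns each
    x^j into z^j x^j; the unit \<open>y\<close> is then cancelled.\<close>
  have "(\<Oplus>j\<in>{..Suc n}. c j \<otimes> z [^] j \<otimes> x [^] j) \<otimes> y = (\<Oplus>j\<in>{..Suc n}. c j \<otimes> z [^] j \<otimes> x [^] j \<otimes> y)"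
    using xc yc z cc by (intro finsum_ldistr) auto
  also have "\<dots> = (\<Oplus>j\<in>{..Suc n}. y \<otimes> (c j \<otimes> x [^] j))"
  proof (intro finsum_cong', goal_cases)
    case (3 j)
    then have j: "j \<le> Suc n" by simp
    have "y \<otimes> (c j \<otimes> x [^] j) = (y \<otimes> c j) \<otimes> x [^] j"
      using cc[OF j] xc yc by (simp add: m_assoc)
    also have "\<dots> = c j \<otimes> (y \<otimes> x [^] j)"
      using Suc.prems(2)[OF j] xc yc m_assoc[of "c j" y "x [^] j"] by simp
    finally have "y \<otimes> (c j \<otimes> x [^] j) = c j \<otimes> (y \<otimes> x [^] j)" .
    then show ?case
      unfolding twisted_power[OF xc yc z zx yx] using cc[OF j] xc yc z by (simp add: m_assoc)
  qed (use xc yc z cc in auto)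
  also have "\<dots> = y \<otimes> (\<Oplus>j\<in>{..Suc n}. c j \<otimes> x [^] j)"
    using xc yc cc by (intro finsum_rdistr[symmetric]) auto
  finally have "(\<Oplus>j\<in>{..Suc n}. c j \<otimes> z [^] j \<otimes> x [^] j) \<otimes> y = \<zero> \<otimes> y"
    using Suc.prems(3) yc by simp
  moreover have S: "(\<Oplus>j\<in>{..Suc n}. c j \<otimes> z [^] j \<otimes> x [^] j) \<in> carrier R"
    using xc z cc by (intro finsum_closed) auto
  ultimately have rel': "(\<Oplus>j\<in>{..Suc n}. c j \<otimes> z [^] j \<otimes> x [^] j) = \<zero>"
    using Units_annihilate[OF y S] yc by simp
  \<comment> \<open>The original relation is subtracted, in the form of multiplication by
    \<open>\<ominus> \<one>\<close> so that distributivity over the sum applies.\<close>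
  have "(\<Oplus>j\<in>{..Suc n}. c j \<otimes> (z [^] j \<ominus> \<one>) \<otimes> x [^] j) =
      (\<Oplus>j\<in>{..Suc n}. c j \<otimes> z [^] j \<otimes> x [^] j \<oplus> (\<ominus> \<one>) \<otimes> (c j \<otimes> x [^] j))"
    using xc z cc by (intro finsum_cong') (auto simp: a_minus_def r_distr l_distr r_minus l_minus)
  also have "\<dots> = (\<Oplus>j\<in>{..Suc n}. c j \<otimes> z [^] j \<otimes> x [^] j) \<oplus> (\<Oplus>j\<in>{..Suc n}. (\<ominus> \<one>) \<otimes> (c j \<otimes> x [^] j))"
    using xc z cc by (intro finsum_addf) auto
  also have "(\<Oplus>j\<in>{..Suc n}. (\<ominus> \<one>) \<otimes> (c j \<otimes> x [^] j)) = (\<ominus> \<one>) \<otimes> (\<Oplus>j\<in>{..Suc n}. c j \<otimes> x [^] j)"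
    using xc cc by (intro finsum_rdistr[symmetric]) auto
  finally have "(\<Oplus>j\<in>{..Suc n}. c j \<otimes> (z [^] j \<ominus> \<one>) \<otimes> x [^] j) = \<zero>"
    unfolding rel' Suc.prems(3) by simp
  \<comment> \<open>The term at index 0 carries z^0 - 1 = 0; all others end in a factor
    \<open>x\<close>.\<close>
  moreover have "(\<Oplus>j\<in>{..Suc n}. c j \<otimes> (z [^] j \<ominus> \<one>) \<otimes> x [^] j)
     = (\<Oplus>j\<in>{..n}. c (Suc j) \<otimes> (z [^] Suc j \<ominus> \<one>) \<otimes> x [^] Suc j) \<oplus> c 0 \<otimes> (z [^] (0::nat) \<ominus> \<one>) \<otimes> x [^] (0::nat)"
    using xc z cc by (intro finsum_Suc2) auto
  moreover have "c 0 \<otimes> (z [^] (0::nat) \<ominus> \<one>) \<otimes> x [^] (0::nat) = \<zero>"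
    using cc[of 0] by (simp add: a_minus_def r_neg)
  moreover have T: "(\<Oplus>j\<in>{..n}. c (Suc j) \<otimes> (z [^] Suc j \<ominus> \<one>) \<otimes> x [^] j) \<in> carrier R"
    using xc z cc by (intro finsum_closed) auto
  moreover have "(\<Oplus>j\<in>{..n}. c (Suc j) \<otimes> (z [^] Suc j \<ominus> \<one>) \<otimes> x [^] Suc j) =
     (\<Oplus>j\<in>{..n}. c (Suc j) \<otimes> (z [^] Suc j \<ominus> \<one>) \<otimes> x [^] j) \<otimes> x"
    using xc z cc by (subst finsum_ldistr) (auto intro!: finsum_cong' simp: m_assoc)
  ultimately have "(\<Oplus>j\<in>{..n}. c (Suc j) \<otimes> (z [^] Suc j \<ominus> \<one>) \<otimes> x [^] j) \<otimes> x = \<zero> \<otimes> x"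
    using xc by simp
  then have rel2: "(\<Oplus>j\<in>{..n}. c (Suc j) \<otimes> (z [^] Suc j \<ominus> \<one>) \<otimes> x [^] j) = \<zero>"
    using Units_annihilate[OF x T] xc by simp
  \<comment> \<open>Multiplying by \<open>?w\<close> turns the leading factor z^(Suc n) - 1 into z -
    1, so lowering the degree by one costs exactly one factor z - 1 in the leading
    coefficient.\<close>
  let ?w = "w (Suc n)"
  have w: "?w \<in> carrier R" "(z [^] Suc n \<ominus> \<one>) \<otimes> ?w = z \<ominus> \<one>" "?w \<otimes> x = x \<otimes> ?w" "?w \<otimes> y = y \<otimes> ?w"
    using Suc.prems(1)[of "Suc n"] by auto
  let ?c = "\<lambda>j. c (Suc j) \<otimes> (z [^] Suc j \<ominus> \<one>) \<otimes> ?w"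
  have "?w \<otimes> x [^] j = x [^] j \<otimes> ?w" for j :: nat
    using group_commutes_pow[of x ?w j] w xc by simp
  then have "(\<Oplus>j\<in>{..n}. ?c j \<otimes> x [^] j) = (\<Oplus>j\<in>{..n}. c (Suc j) \<otimes> (z [^] Suc j \<ominus> \<one>) \<otimes> x [^] j \<otimes> ?w)"
    using xc z cc w(1) by (intro finsum_cong') (auto simp: m_assoc)
  also have "\<dots> = (\<Oplus>j\<in>{..n}. c (Suc j) \<otimes> (z [^] Suc j \<ominus> \<one>) \<otimes> x [^] j) \<otimes> ?w"
    using xc z cc w(1) by (intro finsum_ldistr[symmetric]) auto
  finally have rel3: "(\<Oplus>j\<in>{..n}. ?c j \<otimes> x [^] j) = \<zero>" using rel2 w(1) by simp
  have comm: "?c j \<in> carrier R \<and> ?c j \<otimes> x = x \<otimes> ?c j \<and> ?c j \<otimes> y = y \<otimes> ?c j" if "j \<le> n" for j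
  proof -
    have j: "Suc j \<le> Suc n" using that by simp
    have *: "?c j \<otimes> v = v \<otimes> ?c j" if v: "v \<in> carrier R" "c (Suc j) \<otimes> v = v \<otimes> c (Suc j)"
      "z [^] Suc j \<otimes> v = v \<otimes> z [^] Suc j" "?w \<otimes> v = v \<otimes> ?w" for v
    proof -
      define e where "e = z [^] Suc j \<ominus> \<one>"
      have e: "e \<in> carrier R" "e \<otimes> v = v \<otimes> e"
        using v z unfolding a_minus_def e_def by (simp_all del: nat_pow_Suc add: l_distr r_distr l_minus r_minus)
      have "c (Suc j) \<otimes> e \<otimes> ?w \<otimes> v = c (Suc j) \<otimes> (e \<otimes> v) \<otimes> ?w"
        using v e(1) cc[OF j] w(1) by (simp add: m_assoc)
      also have "\<dots> = v \<otimes> c (Suc j) \<otimes> e \<otimes> ?w"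
        using v(1) e(1) cc[OF j] w(1) unfolding e(2) v(2)[symmetric] by (simp add: m_assoc)
      finally show ?thesis using v(1) e(1) cc[OF j] w(1) unfolding e_def by (simp add: m_assoc)
    qed
    show ?thesis
      using *[OF xc _ zjc(1) w(3)] *[OF yc _ zjc(2) w(4)] Suc.prems(2)[OF j] z w(1)
      by (simp del: nat_pow_Suc)
  qed
  have "?c n \<otimes> (z \<ominus> \<one>) [^] n = \<zero>"
  proof (rule Suc.IH[OF _ _ rel3])
    show "1 \<le> d \<Longrightarrow> d \<le> n \<Longrightarrow> w d \<in> carrier R \<and> (z [^] d \<ominus> \<one>) \<otimes> w d = z \<ominus> \<one> \<and>
      w d \<otimes> x = x \<otimes> w d \<and> w d \<otimes> y = y \<otimes> w d" for d using Suc.prems(1)[of d] by auto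
  qed (use comm in blast)
  moreover have "?c n = c (Suc n) \<otimes> (z \<ominus> \<one>)"
    using w z cc by (simp add: m_assoc del: nat_pow_Suc)
  ultimately have "c (Suc n) \<otimes> ((z \<ominus> \<one>) \<otimes> (z \<ominus> \<one>) [^] n) = \<zero>"
    using z cc by (simp add: m_assoc)
  moreover have "(z \<ominus> \<one>) \<otimes> (z \<ominus> \<one>) [^] n = (z \<ominus> \<one>) [^] Suc n"
    using z by (metis minus_closed nat_pow_Suc2 one_closed)
  ultimately show ?case by simp
qed

section \<open>Unipotent elements of finite order\<close>

lemma add_pow_coprime_zero:
  assumes a: "a \<in> carrier R" and "[(i::int)] \<cdot> a = \<zero>" "[(j::int)] \<cdot> a = \<zero>" "coprime i j"
  shows "a = \<zero>"
proof -
  obtain u v where uv: "u * i + v * j = 1" using assms(4) bezout_int[of i j] by auto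
  have "a = [(u * i + v * j)] \<cdot> a" unfolding uv using a by (simp add: add.int_pow_1)
  also have "\<dots> = [(u * i)] \<cdot> a \<oplus> [(v * j)] \<cdot> a" using a by (simp add: add.int_pow_mult)
  also have "\<dots> = \<zero>" using a assms(2,3)
    by (metis add.int_pow_pow add.int_pow_one mult.commute r_zero zero_closed)
  finally show ?thesis .
qed

text \<open>A binomial expansion stopped after the linear term; all that matters of the remainder is
  its divisibility by u^2.\<close>

lemma power_expansion_square:
  assumes u: "u \<in> carrier R"
  shows "\<exists>w \<in> carrier R. (\<one> \<oplus> u) [^] (j::nat) = \<one> \<oplus> [int j] \<cdot> u \<oplus> u \<otimes> u \<otimes> w"
proof (induction j)
  case 0
  show ?case using u by (intro bexI[of _ \<zero>]) (auto simp: add_pow_def int_pow_0 add.int_pow_closed[unfolded add_pow_def])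
next
  case (Suc j)
  then obtain w where w: "w \<in> carrier R" "(\<one> \<oplus> u) [^] j = \<one> \<oplus> [int j] \<cdot> u \<oplus> u \<otimes> u \<otimes> w" by blast
  have s: "[int (Suc j)] \<cdot> u = [int j] \<cdot> u \<oplus> u"
    using u add.int_pow_mult[of u "int j" 1] by (simp add: add.int_pow_1 Groups.add.commute[of 1])
  have t: "([int j] \<cdot> u) \<otimes> u = u \<otimes> u \<otimes> ([int j] \<cdot> \<one>)"
    using u by (simp add: add_pow_ldistr_int add_pow_rdistr_int)
  have jc: "[int j] \<cdot> u \<in> carrier R" "[int j] \<cdot> \<one> \<in> carrier R" using u by auto
  have "(\<one> \<oplus> u) [^] Suc j = (\<one> \<oplus> [int j] \<cdot> u \<oplus> u \<otimes> u \<otimes> w) \<otimes> (\<one> \<oplus> u)"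
    using w by simp
  also have "\<dots> = \<one> \<oplus> [int j] \<cdot> u \<oplus> u \<otimes> u \<otimes> w \<oplus> (u \<oplus> ([int j] \<cdot> u) \<otimes> u \<oplus> u \<otimes> u \<otimes> w \<otimes> u)"
    using u w jc by (simp add: r_distr l_distr)
  also have "\<dots> = \<one> \<oplus> [int (Suc j)] \<cdot> u \<oplus> u \<otimes> u \<otimes> (w \<oplus> [int j] \<cdot> \<one> \<oplus> w \<otimes> u)"
    unfolding s t using u w jc by (simp add: r_distr m_assoc a_ac)
  finally show ?case using u w jc by blast
qed

text \<open>With u = z - 1, expanding z^q = 1 shows that q u is a multiple of u^2. Hence u^(k+2) = 0
  gives q u^(k+1) = 0, and as \<open>p\<close> kills the ring and is prime to \<open>q\<close>, also
  u^(k+1) = 0. The exponent descends to 1.\<close>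

lemma unipotent_torsion_trivial:
  assumes z: "z \<in> carrier R" and nil: "(z \<ominus> \<one>) [^] (k::nat) = \<zero>" and q: "z [^] (q::nat) = \<one>"
    and char: "[int p] \<cdot> \<one> = \<zero>" and cop: "coprime q p"
  shows "z = \<one>"
proof -
  let ?u = "z \<ominus> \<one>"
  have u: "?u \<in> carrier R" using z by simp
  have z': "z = \<one> \<oplus> ?u"
    using z by (simp add: a_minus_def a_comm[of z] r_neg2)
  obtain w where w: "w \<in> carrier R" "z [^] q = \<one> \<oplus> [int q] \<cdot> ?u \<oplus> ?u \<otimes> ?u \<otimes> w"
    using power_expansion_square[OF u, of q] z' by auto
  have rel: "[int q] \<cdot> ?u \<oplus> ?u \<otimes> ?u \<otimes> w = \<zero>"
    using w q u by (simp add: a_assoc)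
  have step: "?u [^] Suc k = \<zero>" if "?u [^] Suc (Suc k) = \<zero>" for k :: nat
  proof (rule add_pow_coprime_zero[of _ "int q" "int p"])
    have "\<zero> = ?u [^] k \<otimes> ([int q] \<cdot> ?u \<oplus> ?u \<otimes> ?u \<otimes> w)" unfolding rel using u by simp
    also have "\<dots> = [int q] \<cdot> (?u [^] Suc k) \<oplus> ?u [^] Suc (Suc k) \<otimes> w"
      using u w by (simp add: r_distr add_pow_rdistr_int m_assoc)
    also have "\<dots> = [int q] \<cdot> (?u [^] Suc k)" unfolding that using w u by simp
    finally show "[int q] \<cdot> (?u [^] Suc k) = \<zero>" ..
    have "[int p] \<cdot> (?u [^] Suc k) = ([int p] \<cdot> \<one>) \<otimes> (?u [^] Suc k)"
      using u by (subst add_pow_ldistr_int) auto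
    then show "[int p] \<cdot> (?u [^] Suc k) = \<zero>" unfolding char using u by simp
  qed (use u cop in auto)
  have "?u [^] Suc k = \<zero> \<Longrightarrow> ?u = \<zero>" for k :: nat
    by (induction k) (use u step in \<open>simp_all add: nat_pow_Suc[of _ 0] del: nat_pow_Suc\<close>)
  \<comment> \<open>One extra factor makes the starting exponent positive, so that
    \<open>k = 0\<close> needs no separate case.\<close>
  moreover have "?u [^] Suc k = \<zero>" using nil u by simp
  ultimately have "?u = \<zero>" by blast
  then show ?thesis using z' by simp
qed

section \<open>Polynomial relations by counting\<close>

text \<open>There are p^(N+1) coefficient vectors with entries below \<open>p\<close> but at most
  p^N values, so two combinations of 1, x, ..., x^N agree; their difference is the relation. The
  bound on \<open>i J\<close> later makes the leading coefficient prime to \<open>p\<close>.\<close>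

lemma pigeonhole_relation:
  assumes fin: "finite (carrier R)" and card: "card (carrier R) \<le> p ^ N" and p: "1 < p"
    and x: "x \<in> carrier R"
  shows "\<exists>J i. J \<le> N \<and> (\<Oplus>j\<in>{..J}. ([i j] \<cdot> \<one>) \<otimes> x [^] j) = \<zero> \<and> \<bar>i J\<bar> < int p \<and> i J \<noteq> (0::int)"
proof -
  let ?C = "{..N} \<rightarrow>\<^sub>E {0..<p}"
  let ?S = "\<lambda>c. \<Oplus>j\<in>{..N}. ([int (c j)] \<cdot> \<one>) \<otimes> x [^] j"
  have "card ?C = p ^ Suc N" by (simp add: card_PiE)
  also have "\<dots> > p ^ N" using p by simp
  finally have "card (carrier R) < card ?C" using card by linarith
  moreover have "?S ` ?C \<subseteq> carrier R" using x by (auto intro!: finsum_closed)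
  ultimately have "\<not> inj_on ?S ?C" using fin card_inj_on_le[of ?S ?C "carrier R"] by linarith
  then obtain c c' where cc: "c \<in> ?C" "c' \<in> ?C" "c \<noteq> c'" "?S c = ?S c'" by (auto simp: inj_on_def)
  define i where "i j = int (c j) - int (c' j)" for j
  have ex: "\<exists>j\<le>N. i j \<noteq> 0"
  proof (rule ccontr)
    assume "\<not> ?thesis"
    then have "c = c'" using cc(1,2) by (intro PiE_ext[of c "{..N}" _ c']) (auto simp: i_def)
    then show False using cc(3) by simp
  qed
  \<comment> \<open>The top index at which the two vectors differ: cutting the sum there keeps its
    value and leaves a nonzero leading coefficient.\<close>
  define J where "J = Max {j. j \<le> N \<and> i j \<noteq> 0}"
  have fJ: "finite {j. j \<le> N \<and> i j \<noteq> 0}" by simp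
  have J: "J \<le> N" "i J \<noteq> 0" using Max_in[OF fJ] ex unfolding J_def by auto
  have above: "i j = 0" if "J < j" "j \<le> N" for j
    using Max_ge[OF fJ, of j] that unfolding J_def by fastforce
  have "(\<Oplus>j\<in>{..J}. ([i j] \<cdot> \<one>) \<otimes> x [^] j) = (\<Oplus>j\<in>{..N}. ([i j] \<cdot> \<one>) \<otimes> x [^] j)"
    using J(1) above x
    by (intro add.finprod_mono_neutral_cong_left) (auto simp: add_pow_def int_pow_0 add.int_pow_closed[unfolded add_pow_def])
  also have "\<dots> = (\<Oplus>j\<in>{..N}. ([int (c j)] \<cdot> \<one>) \<otimes> x [^] j \<oplus> (\<ominus> \<one>) \<otimes> (([int (c' j)] \<cdot> \<one>) \<otimes> x [^] j))"
  proof (intro finsum_cong', goal_cases)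
    case (3 j)
    have "[i j] \<cdot> \<one> = [int (c j)] \<cdot> \<one> \<oplus> [(- int (c' j))] \<cdot> \<one>"
      unfolding i_def by (simp add: add.int_pow_mult[symmetric])
    also have "[(- int (c' j))] \<cdot> \<one> = \<ominus> ([int (c' j)] \<cdot> \<one>)" by (simp add: add.int_pow_neg)
    finally show ?case using x by (simp add: l_distr l_minus)
  qed (use x in auto)
  also have "\<dots> = ?S c \<oplus> (\<Oplus>j\<in>{..N}. (\<ominus> \<one>) \<otimes> (([int (c' j)] \<cdot> \<one>) \<otimes> x [^] j))"
    using x by (intro finsum_addf) auto
  also have "(\<Oplus>j\<in>{..N}. (\<ominus> \<one>) \<otimes> (([int (c' j)] \<cdot> \<one>) \<otimes> x [^] j)) = (\<ominus> \<one>) \<otimes> ?S c'"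
    using x by (intro finsum_rdistr[symmetric]) auto
  also have "?S c \<oplus> (\<ominus> \<one>) \<otimes> ?S c' = \<zero>"
  proof -
    have "?S c' \<in> carrier R" using x by (intro finsum_closed) auto
    then show ?thesis unfolding cc(4) by (simp add: l_minus r_neg)
  qed
  finally have "(\<Oplus>j\<in>{..J}. ([i j] \<cdot> \<one>) \<otimes> x [^] j) = \<zero>" .
  moreover have "\<bar>i J\<bar> < int p"
    using PiE_mem[OF cc(1), of J] PiE_mem[OF cc(2), of J] J(1) by (auto simp: i_def)
  ultimately show ?thesis using J by blast
qed

text \<open>\<open>N\<close> bounds the degree of the relation found for \<open>x\<close>. Since
  \<open>q\<close> is prime to every degree up to \<open>N\<close>, each elimination step is
  available and yields (z - 1)^J = 0; then \<open>z\<close> is unipotent of order prime to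
  \<open>p\<close>.\<close>

theorem central_commutator_trivial:
  assumes fin: "finite (carrier R)" and card: "card (carrier R) \<le> p ^ N" and p: "prime p"
    and char: "[int p] \<cdot> \<one> = \<zero>"
    and x: "x \<in> Units R" and y: "y \<in> Units R" and z: "z \<in> carrier R"
    and zx: "z \<otimes> x = x \<otimes> z" and zy: "z \<otimes> y = y \<otimes> z" and yx: "y \<otimes> x = z \<otimes> x \<otimes> y"
    and q: "z [^] (q::nat) = \<one>" "coprime q p" "\<And>d. 1 \<le> d \<Longrightarrow> d \<le> N \<Longrightarrow> coprime d q"
  shows "z = \<one>"
proof -
  have xc: "x \<in> carrier R" "y \<in> carrier R" using x y by auto
  obtain J i where J: "J \<le> N" and rel: "(\<Oplus>j\<in>{..J}. ([i j] \<cdot> \<one>) \<otimes> x [^] j) = \<zero>"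
    and i: "\<bar>i J\<bar> < int p" "i J \<noteq> (0::int)"
    using pigeonhole_relation[OF fin card _ xc(1)] prime_gt_1_nat[OF p] by blast
  have "\<exists>w. w \<in> carrier R \<and> (z [^] d \<ominus> \<one>) \<otimes> w = z \<ominus> \<one> \<and> w \<otimes> x = x \<otimes> w \<and> w \<otimes> y = y \<otimes> w"
    if d: "1 \<le> d" "d \<le> J" for d
  proof -
    \<comment> \<open>\<open>e\<close> inverts \<open>d\<close> modulo \<open>q\<close>, so z =
      (z^d)^e, and the geometric factor of z^d is the required cofactor.\<close>
    have "coprime d q" using q(3) d J by auto
    then obtain e t where et: "d * e = q * t + 1"
      using bezout_nat[of d q] d by auto
    have "(z [^] d) [^] e = z"
      using z q(1) by (simp add: nat_pow_pow et nat_pow_mult[symmetric] nat_pow_pow[symmetric])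
    moreover obtain w where w: "w \<in> carrier R" "(z [^] d) [^] e \<ominus> \<one> = (z [^] d \<ominus> \<one>) \<otimes> w"
      "\<And>b. b \<in> carrier R \<Longrightarrow> z [^] d \<otimes> b = b \<otimes> z [^] d \<Longrightarrow> w \<otimes> b = b \<otimes> w"
      using geometric_factor[of "z [^] d" e] z by auto
    moreover have "z [^] d \<otimes> x = x \<otimes> z [^] d" "z [^] d \<otimes> y = y \<otimes> z [^] d"
      using group_commutes_pow z xc zx zy by auto
    ultimately show ?thesis using xc by metis
  qed
  then obtain w where w: "\<And>d. 1 \<le> d \<Longrightarrow> d \<le> J \<Longrightarrow> w d \<in> carrier R \<and> (z [^] d \<ominus> \<one>) \<otimes> w d = z \<ominus> \<one> \<and>
      w d \<otimes> x = x \<otimes> w d \<and> w d \<otimes> y = y \<otimes> w d"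
    by metis
  have "([i J] \<cdot> \<one>) \<otimes> (z \<ominus> \<one>) [^] J = \<zero>"
  proof (rule twisted_relation[OF x y z zx zy yx w _ rel])
    show "([i j] \<cdot> \<one>) \<in> carrier R \<and> ([i j] \<cdot> \<one>) \<otimes> x = x \<otimes> ([i j] \<cdot> \<one>) \<and>
        ([i j] \<cdot> \<one>) \<otimes> y = y \<otimes> ([i j] \<cdot> \<one>)" for j
      using xc by (simp add: add_pow_ldistr_int add_pow_rdistr_int)
  qed
  then have 1: "[i J] \<cdot> ((z \<ominus> \<one>) [^] J) = \<zero>"
    using z by (simp add: add_pow_ldistr_int)
  have "[int p] \<cdot> ((z \<ominus> \<one>) [^] J) = ([int p] \<cdot> \<one>) \<otimes> (z \<ominus> \<one>) [^] J"
    using z by (simp add: add_pow_ldistr_int)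
  then have 2: "[int p] \<cdot> ((z \<ominus> \<one>) [^] J) = \<zero>" unfolding char using z by simp
  have "\<not> int p dvd i J" using i zdvd_not_zless[of "\<bar>i J\<bar>" "int p"] by auto
  then have "coprime (i J) (int p)"
    using p by (metis coprime_commute prime_imp_coprime prime_nat_int_transfer)
  then have "(z \<ominus> \<one>) [^] J = \<zero>" using add_pow_coprime_zero[OF _ 1 2] z by simp
  then show ?thesis using unipotent_torsion_trivial[OF z _ q(1) char q(2)] by blast
qed

end

section \<open>Finite groups of prime power order\<close>

text \<open>The first isomorphism theorem combined with Lagrange; the codomain is shrunk to the
  image to make \<open>h\<close> surjective.\<close>

lemma (in group_hom) card_image_mult_card_kernel:
  "card (h ` carrier G) * card (kernel G H h) = order G"
proof -
  interpret im: group_hom G "H\<lparr>carrier := h ` carrier G\<rparr>" h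
    using img_is_subgroup H.subgroup_imp_group
    by (intro group_hom.intro group_hom_axioms.intro) (auto simp: hom_def)
  have k: "kernel G (H\<lparr>carrier := h ` carrier G\<rparr>) h = kernel G H h" by (simp add: kernel_def)
  have "card (carrier (G Mod kernel G H h)) = card (h ` carrier G)"
    using iso_same_card[OF im.FactGroup_iso] unfolding k by simp
  then show ?thesis
    using G.lagrange[OF subgroup_kernel] by (simp add: FactGroup_def)
qed

text \<open>The class equation: conjugacy classes have \<open>r\<close>-power size, and with a
  trivial centre only the class of \<open>\<one>\<close> would have size 1, making the group order 1
  modulo \<open>r\<close>.\<close>

lemma (in group) prime_power_order_center_nontrivial:
  assumes r: "prime (r::nat)" and ord: "order G = r ^ Suc a"
  shows "\<exists>c \<in> carrier G. c \<noteq> \<one> \<and> (\<forall>g \<in> carrier G. c \<otimes> g = g \<otimes> c)"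
proof (rule ccontr)
  assume no: "\<not> ?thesis"
  let ?\<phi> = "\<lambda>g. \<lambda>h \<in> carrier G. g \<otimes> h \<otimes> inv g"
  interpret A: group_action G "carrier G" ?\<phi> by (rule action_by_conjugation)
  have fin: "finite (carrier G)"
    using ord prime_gt_0_nat[OF r] order_gt_0_iff_finite by simp
  let ?O = "orbits G (carrier G) ?\<phi>"
  have finO: "finite ?O" using fin finite_UnionD[of ?O] A.orbits_coverture by simp
  have orb1: "orbit G ?\<phi> \<one> = {\<one>}"
    unfolding orbit_def by (auto, rule exI[of _ \<one>], simp)
  then have mem1: "{\<one>} \<in> ?O" unfolding orbits_def by force
  have dvd: "r dvd card Y" if Y: "Y \<in> ?O" "Y \<noteq> {\<one>}" for Y
  proof -
    obtain x where x: "x \<in> carrier G" "Y = orbit G ?\<phi> x" using Y(1) unfolding orbits_def by blast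
    have "card Y dvd r ^ Suc a"
      using A.orbit_stabilizer_theorem[OF x(1)] unfolding x(2) ord by (intro dvdI[OF sym])
    then obtain i where i: "card Y = r ^ i" using divides_primepow_nat[OF r] by blast
    have xY: "x \<in> Y" using A.orbit_refl[OF x(1)] x(2) by simp
    have "i \<noteq> 0"
    proof
      assume "i = 0"
      then obtain w where "Y = {w}" using i by (auto simp: card_1_singleton_iff)
      then have "Y = {x}" using xY by simp
      have *: "g \<otimes> x \<otimes> inv g = x" if "g \<in> carrier G" for g
      proof -
        have "?\<phi> g x \<in> Y" using that unfolding x(2) orbit_def by blast
        then show ?thesis using \<open>Y = {x}\<close> x(1) by simp
      qed
      have "x \<otimes> g = g \<otimes> x" if g: "g \<in> carrier G" for g
      proof -
        have "x \<otimes> g = g \<otimes> x \<otimes> inv g \<otimes> g" using *[OF g] by simp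
        then show ?thesis using g x(1) by (simp add: m_assoc)
      qed
      then have "x = \<one>" using no x(1) by blast
      then show False using \<open>Y = {x}\<close> Y(2) by simp
    qed
    then show ?thesis using i by simp
  qed
  have "order G = (\<Sum>Y\<in>?O. card Y)"
    using A.disjoint_sum[OF fin, of "\<lambda>_. 1::nat"] by (simp add: order_def)
  also have "\<dots> = 1 + (\<Sum>Y\<in>?O - {{\<one>}}. card Y)"
    using finO mem1 by (simp add: sum.remove)
  finally have "order G = 1 + (\<Sum>Y\<in>?O - {{\<one>}}. card Y)" .
  moreover have "r dvd (\<Sum>Y\<in>?O - {{\<one>}}. card Y)" using dvd by (intro dvd_sum) auto
  moreover have "r dvd order G" using ord by simp
  ultimately have "r dvd 1" by (simp only: dvd_add_left_iff)
  then show False using r by simp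
qed

text \<open>The element \<open>x\<close> comes from the second centre: the quotient by the centre
  \<open>Z\<close> is a nontrivial \<open>r\<close>-group, so some noncentral \<open>x\<close> is
  central modulo \<open>Z\<close>. Its commutator with any \<open>y\<close> not commuting with it
  lies in \<open>Z\<close> and is nontrivial.\<close>

lemma (in group) prime_power_order_central_commutator:
  assumes r: "prime (r::nat)" and ord: "order G = r ^ a"
    and nc: "u \<in> carrier G" "v \<in> carrier G" "u \<otimes> v \<noteq> v \<otimes> u"
  shows "\<exists>x \<in> carrier G. \<exists>y \<in> carrier G. \<exists>z \<in> carrier G.
    z \<noteq> \<one> \<and> y \<otimes> x = z \<otimes> x \<otimes> y \<and> z \<otimes> x = x \<otimes> z \<and> z \<otimes> y = y \<otimes> z"
proof -
  define Z where "Z = {c \<in> carrier G. \<forall>g \<in> carrier G. c \<otimes> g = g \<otimes> c}"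
  have Zc: "c \<otimes> g = g \<otimes> c" if "c \<in> Z" "g \<in> carrier G" for c g using that by (simp add: Z_def)
  have sub: "subgroup Z G"
  proof (rule subgroupI)
    fix c assume c: "c \<in> Z"
    then have cc: "c \<in> carrier G" by (simp add: Z_def)
    have "inv c \<otimes> g = g \<otimes> inv c" if g: "g \<in> carrier G" for g
      using Zc[OF c g] cc g by (metis inv_closed inv_solve_left inv_solve_right m_assoc m_closed)
    then show "inv c \<in> Z" using cc by (simp add: Z_def)
  next
    fix c d assume cd: "c \<in> Z" "d \<in> Z"
    then have cc: "c \<in> carrier G" "d \<in> carrier G" by (simp_all add: Z_def)
    have "c \<otimes> d \<otimes> g = g \<otimes> (c \<otimes> d)" if g: "g \<in> carrier G" for g
    proof -
      have "c \<otimes> d \<otimes> g = c \<otimes> g \<otimes> d" using Zc[OF cd(2) g] cc g by (simp add: m_assoc)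
      then show ?thesis using Zc[OF cd(1) g] cc g by (simp add: m_assoc)
    qed
    then show "c \<otimes> d \<in> Z" using cc by (simp add: Z_def)
  qed (auto simp: Z_def)
  have "Z \<lhd> G"
  proof (unfold normal_inv_iff, intro conjI sub ballI)
    fix g c assume g: "g \<in> carrier G" "c \<in> Z"
    then have "g \<otimes> c \<otimes> inv g = c"
      using Zc[OF g(2,1)] by (metis (no_types, lifting) Z_def inv_solve_right' mem_Collect_eq m_closed)
    then show "g \<otimes> c \<otimes> inv g \<in> Z" using g by simp
  qed
  then interpret Z: normal Z G .
  let ?T = "G Mod Z"
  interpret T: group ?T by (rule Z.factorgroup_is_group)
  have "order ?T * card Z = r ^ a" using lagrange[OF sub] ord by (simp add: order_def FactGroup_def)
  then have "order ?T dvd r ^ a" by (metis dvd_triv_left)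
  then obtain b where b: "order ?T = r ^ b" using divides_primepow_nat[OF r] by blast
  have "b \<noteq> 0"
  proof
    assume "b = 0"
    then have "carrier ?T = {\<one>\<^bsub>?T\<^esub>}" using b T.order_one_triv_iff by simp
    then have "Z #> u = Z" using nc(1) by (auto simp: carrier_FactGroup)
    then have "u \<in> Z" using coset_join1[OF _ nc(1) sub] by simp
    then show False using Zc nc by blast
  qed
  then obtain b' where "b = Suc b'" using not0_implies_Suc by blast
  then have "\<exists>C \<in> carrier ?T. C \<noteq> \<one>\<^bsub>?T\<^esub> \<and> (\<forall>D \<in> carrier ?T. C \<otimes>\<^bsub>?T\<^esub> D = D \<otimes>\<^bsub>?T\<^esub> C)"
    using T.prime_power_order_center_nontrivial[OF r, of b'] b by simp
  then obtain C where C: "C \<in> carrier ?T" "C \<noteq> \<one>\<^bsub>?T\<^esub>"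
    "\<And>D. D \<in> carrier ?T \<Longrightarrow> C \<otimes>\<^bsub>?T\<^esub> D = D \<otimes>\<^bsub>?T\<^esub> C"
    by blast
  obtain x where x: "x \<in> carrier G" "C = Z #> x" using C(1) by (auto simp: carrier_FactGroup)
  have "x \<notin> Z" using C(2) x coset_join2[OF x(1) sub] by auto
  then obtain y where y: "y \<in> carrier G" "x \<otimes> y \<noteq> y \<otimes> x" using x(1) unfolding Z_def by blast
  have "Z #> (y \<otimes> x) = Z #> (x \<otimes> y)"
    using C(3)[of "Z #> y"] x y(1) Z.rcos_sum[of x y] Z.rcos_sum[of y x] by (simp add: carrier_FactGroup)
  then have "y \<otimes> x \<in> Z #> (x \<otimes> y)" using rcos_self[OF _ sub, of "y \<otimes> x"] x y by simp
  then obtain z where z: "z \<in> Z" "y \<otimes> x = z \<otimes> (x \<otimes> y)" unfolding r_coset_def by blast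
  have zc: "z \<in> carrier G" using z(1) subgroup.subset[OF sub] by blast
  have "z \<noteq> \<one>" using z(2) x(1) y by force
  moreover have "y \<otimes> x = z \<otimes> x \<otimes> y" unfolding z(2) using zc x(1) y(1) by (rule m_assoc[symmetric])
  ultimately show ?thesis using zc x(1) y(1) Zc[OF z(1) x(1)] Zc[OF z(1) y(1)] by blast
qed

text \<open>A Sylow \<open>r\<close>-subgroup of the preimage of an \<open>r\<close>-group maps onto that \<open>r\<close>-group.\<close>

lemma (in group_hom) prime_power_subgroup_onto:
  assumes r: "prime (r::nat)" and fin: "finite (carrier G)" and card: "card (h ` carrier G) = r ^ j"
  shows "\<exists>S a. subgroup S G \<and> card S = r ^ a \<and> h ` S = h ` carrier G"
proof -
  let ?N = "kernel G H h"
  have o: "r ^ j * card ?N = order G" unfolding card[symmetric] by (rule card_image_mult_card_kernel)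
  have pos: "order G \<noteq> 0" using fin G.order_gt_0_iff_finite by simp
  obtain m where m: "order G = r ^ multiplicity r (order G) * m" "\<not> r dvd m"
    using multiplicity_decompose'[OF pos, of r] r by (metis not_prime_unit)
  define a where "a = multiplicity r (order G)"
  obtain S where S: "subgroup S G" "card S = r ^ a"
    using sylow_thm[OF r G.is_group m(1) fin] unfolding a_def by blast
  interpret S: group_hom "G\<lparr>carrier := S\<rparr>" H h
    using G.subgroup_imp_group[OF S(1)] subgroup.subset[OF S(1)]
    by (intro group_hom.intro group_hom_axioms.intro) (auto simp: hom_def subset_iff)
  have k: "kernel (G\<lparr>carrier := S\<rparr>) H h = S \<inter> ?N"
    using subgroup.subset[OF S(1)] by (auto simp: kernel_def)
  have o': "card (h ` S) * card (S \<inter> ?N) = r ^ a"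
    using S.card_image_mult_card_kernel S(2) unfolding k by (simp add: order_def)
  have "card (S \<inter> ?N) dvd r ^ a" unfolding o'[symmetric] by (rule dvd_triv_right)
  then obtain i where i: "card (S \<inter> ?N) = r ^ i"
    using divides_primepow_nat[OF r] by blast
  \<comment> \<open>As r^i divides the order of the kernel, r^(j+i) divides the order of
    \<open>G\<close> and j + i <= a. So the image of \<open>S\<close>, of order r^(a-i), has at
    least r^j elements and is everything.\<close>
  have "subgroup (S \<inter> ?N) (G\<lparr>carrier := ?N\<rparr>)"
    using G.subgroups_Inter_pair[OF S(1) subgroup_kernel] subgroup_kernel G.subgroup_incl by blast
  then have "card (S \<inter> ?N) dvd card ?N"
    using group.lagrange[OF G.subgroup_imp_group[OF subgroup_kernel], of "S \<inter> ?N"]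
    by (simp add: order_def) (metis dvd_triv_right)
  then have "r ^ (j + i) dvd order G" unfolding o[symmetric] power_add i[symmetric] by simp
  then have "j + i \<le> a" unfolding a_def
    using pos r by (intro multiplicity_geI) auto
  moreover have "card (h ` S) * r ^ i = r ^ (a - i) * r ^ i"
    using o' i calculation by (simp flip: power_add)
  ultimately have "card (h ` S) = r ^ (a - i)" "j \<le> a - i" using prime_gt_0_nat[OF r] by auto
  then have "card (h ` carrier G) \<le> card (h ` S)"
    using card prime_gt_0_nat[OF r] by (simp add: power_increasing)
  then have "h ` S = h ` carrier G"
    using fin subgroup.subset[OF S(1)] by (intro card_seteq) auto
  then show ?thesis using S by blast
qed

text \<open>\<open>L\<close> may be infinite, so Sylow theory is applied to a finite subgroup of the
  product of \<open>M\<close> and \<open>Q\<close>. By \<open>ker\<close>, an element of that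
  subgroup with trivial first coordinate is trivial, so a central commutator found there survives in
  \<open>M\<close>.\<close>

lemma section_central_commutator:
  assumes L: "group L" and M: "group M" and Q: "group Q"
    and fin: "finite (carrier M)" "finite (carrier Q)"
    and \<alpha>: "\<alpha> \<in> hom L M" and f: "f \<in> hom L Q"
    and ker: "\<And>h. h \<in> carrier L \<Longrightarrow> \<alpha> h = \<one>\<^bsub>M\<^esub> \<Longrightarrow> f h = \<one>\<^bsub>Q\<^esub>"
    and R: "subgroup R Q" "R \<subseteq> f ` carrier L" "card R = r ^ j" "prime (r::nat)"
    and nc: "u \<in> R" "v \<in> R" "u \<otimes>\<^bsub>Q\<^esub> v \<noteq> v \<otimes>\<^bsub>Q\<^esub> u"
  shows "\<exists>x \<in> carrier M. \<exists>y \<in> carrier M. \<exists>z \<in> carrier M. \<exists>e. z \<noteq> \<one>\<^bsub>M\<^esub> \<and>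
    y \<otimes>\<^bsub>M\<^esub> x = z \<otimes>\<^bsub>M\<^esub> x \<otimes>\<^bsub>M\<^esub> y \<and> z \<otimes>\<^bsub>M\<^esub> x = x \<otimes>\<^bsub>M\<^esub> z \<and>
    z \<otimes>\<^bsub>M\<^esub> y = y \<otimes>\<^bsub>M\<^esub> z \<and> z [^]\<^bsub>M\<^esub> (r ^ e) = \<one>\<^bsub>M\<^esub>"
proof -
  interpret L: group L by fact
  interpret M: group M by fact
  interpret Q: group Q by fact
  interpret \<alpha>: group_hom L M \<alpha> by unfold_locales fact
  interpret f: group_hom L Q f by unfold_locales fact
  interpret R: subgroup R Q by fact
  let ?D = "M \<times>\<times> Q"
  interpret D: group ?D by (rule DirProd_group[OF M Q])
  \<comment> \<open>The joint image, in the product, of the preimage of \<open>R\<close>; its second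
    projection is onto \<open>R\<close>.\<close>
  define P where "P = (\<lambda>h. (\<alpha> h, f h)) ` {h \<in> carrier L. f h \<in> R}"
  have P: "subgroup P ?D"
  proof (rule D.subgroupI)
    have "\<one>\<^bsub>L\<^esub> \<in> {h \<in> carrier L. f h \<in> R}" by simp
    then show "P \<noteq> {}" unfolding P_def by blast
  next
    fix p assume "p \<in> P"
    then obtain h where h: "h \<in> carrier L" "f h \<in> R" "p = (\<alpha> h, f h)" unfolding P_def by blast
    have "inv\<^bsub>?D\<^esub> p = (\<alpha> (inv\<^bsub>L\<^esub> h), f (inv\<^bsub>L\<^esub> h))" using h by (simp add: inv_DirProd M Q)
    moreover have "f (inv\<^bsub>L\<^esub> h) \<in> R" using h by simp
    ultimately show "inv\<^bsub>?D\<^esub> p \<in> P" unfolding P_def using h(1) by blast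
  next
    fix p p' assume "p \<in> P" "p' \<in> P"
    then obtain h h' where h: "h \<in> carrier L" "f h \<in> R" "p = (\<alpha> h, f h)"
      "h' \<in> carrier L" "f h' \<in> R" "p' = (\<alpha> h', f h')" unfolding P_def by blast
    then have "p \<otimes>\<^bsub>?D\<^esub> p' = (\<alpha> (h \<otimes>\<^bsub>L\<^esub> h'), f (h \<otimes>\<^bsub>L\<^esub> h'))" "f (h \<otimes>\<^bsub>L\<^esub> h') \<in> R" by simp_all
    then show "p \<otimes>\<^bsub>?D\<^esub> p' \<in> P" unfolding P_def using h by blast
  qed (auto simp: P_def)
  let ?P = "?D\<lparr>carrier := P\<rparr>"
  interpret P: group ?P by (rule D.subgroup_imp_group[OF P])
  interpret s: group_hom ?P Q snd
    using subgroup.subset[OF P] by unfold_locales (auto simp: hom_def mult_DirProd')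
  have img: "snd ` carrier ?P = R" using R(2) by (force simp: P_def)
  have "finite P" using subgroup.subset[OF P] fin by (auto intro: finite_subset)
  then obtain S a where S: "subgroup S ?P" "card S = r ^ a" "snd ` S = R"
    using s.prime_power_subgroup_onto[OF R(4), of j] img R(3) by auto
  have SP: "S \<subseteq> P" using subgroup.subset[OF S(1)] by simp
  have PD: "P \<subseteq> carrier ?D" using subgroup.subset[OF P] .
  let ?S = "?P\<lparr>carrier := S\<rparr>"
  interpret S: group ?S by (rule P.subgroup_imp_group[OF S(1)])
  obtain p q where pq: "p \<in> S" "q \<in> S" "snd p = u" "snd q = v" using nc(1,2) S(3) by blast
  have npq: "p \<otimes>\<^bsub>?S\<^esub> q \<noteq> q \<otimes>\<^bsub>?S\<^esub> p"
  proof
    assume "p \<otimes>\<^bsub>?S\<^esub> q = q \<otimes>\<^bsub>?S\<^esub> p"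
    then have "snd (p \<otimes>\<^bsub>?D\<^esub> q) = snd (q \<otimes>\<^bsub>?D\<^esub> p)" by simp
    then show False using nc(3) pq by (simp add: mult_DirProd')
  qed
  have ordS: "order ?S = r ^ a" using S(2) by (simp add: order_def)
  obtain x y z where "x \<in> carrier ?S" "y \<in> carrier ?S" "z \<in> carrier ?S" "z \<noteq> \<one>\<^bsub>?S\<^esub>"
    "y \<otimes>\<^bsub>?S\<^esub> x = z \<otimes>\<^bsub>?S\<^esub> x \<otimes>\<^bsub>?S\<^esub> y" "z \<otimes>\<^bsub>?S\<^esub> x = x \<otimes>\<^bsub>?S\<^esub> z" "z \<otimes>\<^bsub>?S\<^esub> y = y \<otimes>\<^bsub>?S\<^esub> z"
  proof -
    have "p \<in> carrier ?S" "q \<in> carrier ?S" using pq by simp_all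
    from S.prime_power_order_central_commutator[OF R(4) ordS this npq] show ?thesis
      by (elim bexE conjE) (rule that)
  qed
  then have xyz: "x \<in> S" "y \<in> S" "z \<in> S" "z \<noteq> \<one>\<^bsub>?D\<^esub>"
    "y \<otimes>\<^bsub>?D\<^esub> x = z \<otimes>\<^bsub>?D\<^esub> x \<otimes>\<^bsub>?D\<^esub> y" "z \<otimes>\<^bsub>?D\<^esub> x = x \<otimes>\<^bsub>?D\<^esub> z" "z \<otimes>\<^bsub>?D\<^esub> y = y \<otimes>\<^bsub>?D\<^esub> z"
    by simp_all
  have car: "x \<in> carrier ?D" "y \<in> carrier ?D" "z \<in> carrier ?D" using xyz(1-3) SP PD by auto
  interpret fst: group_hom ?D M fst by unfold_locales (auto simp: hom_def mult_DirProd')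
  have "z [^]\<^bsub>?S\<^esub> (r ^ a) = \<one>\<^bsub>?S\<^esub>"
    using S.pow_order_eq_1[of z] xyz(3) S(2) by (simp add: order_def)
  then have "z [^]\<^bsub>?D\<^esub> (r ^ a) = \<one>\<^bsub>?D\<^esub>" by (simp add: nat_pow_def)
  then have pow: "fst z [^]\<^bsub>M\<^esub> (r ^ a) = \<one>\<^bsub>M\<^esub>"
    using fst.hom_nat_pow[OF car(3), of "r ^ a"] by simp
  have "fst z \<noteq> \<one>\<^bsub>M\<^esub>"
  proof
    assume 1: "fst z = \<one>\<^bsub>M\<^esub>"
    obtain h where "h \<in> carrier L" "z = (\<alpha> h, f h)" using xyz(3) SP unfolding P_def by blast
    then show False using ker[of h] 1 xyz(4) by simp
  qed
  moreover have "fst y \<otimes>\<^bsub>M\<^esub> fst x = fst z \<otimes>\<^bsub>M\<^esub> fst x \<otimes>\<^bsub>M\<^esub> fst y"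
    using arg_cong[OF xyz(5), of fst] by (simp add: mult_DirProd')
  moreover have "fst z \<otimes>\<^bsub>M\<^esub> fst x = fst x \<otimes>\<^bsub>M\<^esub> fst z" "fst z \<otimes>\<^bsub>M\<^esub> fst y = fst y \<otimes>\<^bsub>M\<^esub> fst z"
    using arg_cong[OF xyz(6), of fst] arg_cong[OF xyz(7), of fst] by (simp_all add: mult_DirProd')
  ultimately show ?thesis using pow car fst.hom_closed by blast
qed

section \<open>Symmetric groups\<close>

text \<open>One more point is sent to its target by a final transposition that fixes all targets
  already reached.\<close>

lemma permutes_extend:
  assumes "finite A" "distinct xs" "distinct ys" "length xs = length ys" "set xs \<subseteq> A" "set ys \<subseteq> A"
  shows "\<exists>g. g permutes A \<and> map g xs = ys"
  using assms
proof (induction xs arbitrary: ys rule: rev_induct)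
  case Nil
  then have "id permutes A \<and> map id [] = ys" by (simp add: permutes_id)
  then show ?case by blast
next
  case (snoc x xs)
  then obtain y ys' where ys: "ys = ys' @ [y]" by (cases ys rule: rev_cases) auto
  obtain g where g: "g permutes A" "map g xs = ys'" using snoc ys by auto
  let ?g = "Transposition.transpose (g x) y \<circ> g"
  have "?g permutes A"
    using snoc ys g by (intro permutes_compose[OF g(1)] permutes_swap_id) (auto simp: permutes_in_image)
  moreover have "?g v = g v" if v: "v \<in> set xs" for v
  proof -
    have "g v \<noteq> g x" using snoc.prems(2) v inj_eq[OF permutes_inj[OF g(1)]] by auto
    moreover have "g v \<noteq> y" using snoc.prems(3) v ys g(2) by auto
    ultimately show ?thesis by simp
  qed
  then have "map ?g xs = ys'" unfolding g(2)[symmetric] by (intro map_cong refl)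
  then have "map ?g (xs @ [x]) = ys" using ys by simp
  ultimately show ?case by blast
qed

text \<open>Conjugation relabels the points on which \<open>y\<close> acts, so \<open>g\<close>
  needs to be prescribed only at a few points, chosen to make the two products differ at a point
  \<open>i\<close> moved by \<open>x\<close>.\<close>

lemma noncommuting_conjugate:
  fixes x y :: "'a \<Rightarrow> 'a"
  assumes fin: "finite A" and card: "5 \<le> card A"
    and x: "x permutes A" "x \<noteq> id" and y: "y permutes A" "y \<noteq> id"
  shows "\<exists>g. g permutes A \<and> x \<circ> (g \<circ> y \<circ> inv' g) \<noteq> (g \<circ> y \<circ> inv' g) \<circ> x"
proof -
  obtain i where i: "x i \<noteq> i" using x(2) by (auto simp: fun_eq_iff)
  then have iA: "i \<in> A" "x i \<in> A" using permutes_not_in[OF x(1)] permutes_in_image[OF x(1)] by blast+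
  show ?thesis
  proof (cases "\<exists>f\<in>A. y f = f")
    case True
    then obtain f where f: "f \<in> A" "y f = f" by blast
    obtain m where m: "y m \<noteq> m" using y(2) by (auto simp: fun_eq_iff)
    then have mA: "m \<in> A" using permutes_not_in[OF y(1)] by blast
    \<comment> \<open>The conjugate fixes \<open>i\<close> and moves \<open>x i\<close>, so one
      product sends \<open>i\<close> to \<open>x i\<close> and the other does not.\<close>
    obtain g where g: "g permutes A" "map g [f, m] = [i, x i]"
      using permutes_extend[OF fin, of "[f, m]" "[i, x i]"] f m mA i iA by auto
    have gi: "inv' g i = f" "inv' g (x i) = m"
      using g(2) permutes_inverses(2)[OF g(1), of f] permutes_inverses(2)[OF g(1), of m] by simp_all
    have "g (y m) \<noteq> x i" using g(2) m inj_eq[OF permutes_inj[OF g(1)], of "y m" m] by simp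
    then have "(x \<circ> (g \<circ> y \<circ> inv' g)) i \<noteq> ((g \<circ> y \<circ> inv' g) \<circ> x) i"
      using gi g(2) f(2) by simp
    then show ?thesis using g(1) by metis
  next
    case False
    define u where "u = i"
    have u: "u \<in> A" "y u \<in> A" "y u \<noteq> u" using iA False permutes_in_image[OF y(1)] by (auto simp: u_def)
    have choose: "\<exists>s\<in>A. s \<notin> set l" if "length l \<le> 4" for l
      using card_mono[of "set l" A] card_length[of l] that card by fastforce
    \<comment> \<open>Excluding \<open>inv' y u\<close> as well keeps \<open>y s\<close> away from
      \<open>u\<close>, so that \<open>u\<close>, \<open>s\<close>, \<open>y u\<close>,
      \<open>y s\<close> are four distinct points.\<close>
    obtain s where s: "s \<in> A" "s \<notin> {u, y u, inv' y u}" using choose[of "[u, y u, inv' y u]"] by auto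
    have inj: "y a = y b \<longleftrightarrow> a = b" for a b using permutes_inj[OF y(1)] by (auto dest: injD)
    have t: "y s \<in> A" "y s \<noteq> s" "y s \<noteq> u" "y s \<noteq> y u"
      using s False permutes_in_image[OF y(1)] permutes_inverses(2)[OF y(1), of s] by (auto simp: inj)
    obtain a where a: "a \<in> A" "a \<notin> {i, x i}" using choose[of "[i, x i]"] by auto
    \<comment> \<open>The conjugate will send \<open>i\<close> to \<open>a\<close> and
      \<open>x i\<close> to \<open>b\<close>, so the products send \<open>i\<close> to
      \<open>x a\<close> and to \<open>b\<close>. Avoiding four points here is what requires five
      points in \<open>A\<close>.\<close>
    obtain b where b: "b \<in> A" "b \<notin> {i, x i, a, x a}" using choose[of "[i, x i, a, x a]"] by auto
    obtain g where g: "g permutes A" "map g [u, s, y u, y s] = [i, x i, a, b]"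
      using permutes_extend[OF fin, of "[u, s, y u, y s]" "[i, x i, a, b]"] i iA u s t a b by auto
    have gi: "inv' g i = u" "inv' g (x i) = s"
      using g(2) permutes_inverses(2)[OF g(1), of u] permutes_inverses(2)[OF g(1), of s] by simp_all
    have "(x \<circ> (g \<circ> y \<circ> inv' g)) i \<noteq> ((g \<circ> y \<circ> inv' g) \<circ> x) i"
      using gi g(2) b(2) by auto
    then show ?thesis using g(1) by metis
  qed
qed

section \<open>Generation of the symmetric group by two elements\<close>

definition full_cycle :: "nat \<Rightarrow> nat \<Rightarrow> nat" where
  "full_cycle k x = (if x \<in> {1..<k} then Suc x else if x = k then 1 else x)"

lemma full_cycle_permutes: "0 < k \<Longrightarrow> full_cycle k permutes {1..k}"
  by (rule inj_imp_permutes) (auto simp: full_cycle_def inj_on_def split: if_splits)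

text \<open>Conjugating (1 2) by powers of the cycle gives all adjacent transpositions, these give
  all transpositions, and those give all permutations.\<close>

lemma sym_group_two_generators:
  assumes k: "2 \<le> k" and T: "subgroup T (sym_group k)"
    and gens: "Transposition.transpose 1 2 \<in> T" "full_cycle k \<in> T"
  shows "T = carrier (sym_group k)"
proof -
  interpret T: subgroup T "sym_group k" by fact
  have comp: "p \<circ> q \<in> T" if "p \<in> T" "q \<in> T" for p q
    using T.m_closed[OF that] by (simp add: sym_group_mult)
  have c: "full_cycle k permutes {1..k}" using k by (intro full_cycle_permutes) auto
  have inv: "inv' (full_cycle k) \<in> T"
    using T.m_inv_closed[OF gens(2)] sym_group_inv_equality[of "full_cycle k" k] c
    by (simp add: sym_group_carrier)
  have adj: "Suc i < k \<longrightarrow> Transposition.transpose (Suc i) (Suc (Suc i)) \<in> T" for i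
  proof (induction i)
    case 0
    show ?case using gens(1) by (simp add: numeral_2_eq_2)
  next
    case (Suc i)
    show ?case
    proof
      assume i: "Suc (Suc i) < k"
      let ?t = "Transposition.transpose (Suc i) (Suc (Suc i))"
      \<comment> \<open>Both points moved by \<open>?t\<close> are below \<open>k\<close>, so the
        cycle acts on them as the successor, without wrapping round.\<close>
      have "Transposition.transpose (Suc (Suc i)) (Suc (Suc (Suc i))) \<circ> full_cycle k = full_cycle k \<circ> ?t"
        using i by (auto simp: fun_eq_iff transpose_def full_cycle_def)
      then have "Transposition.transpose (Suc (Suc i)) (Suc (Suc (Suc i))) \<circ> (full_cycle k \<circ> inv' (full_cycle k))
          = full_cycle k \<circ> ?t \<circ> inv' (full_cycle k)" by (simp add: o_assoc)
      then have "Transposition.transpose (Suc (Suc i)) (Suc (Suc (Suc i)))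
          = full_cycle k \<circ> ?t \<circ> inv' (full_cycle k)" by (simp add: permutes_inv_o(1)[OF c])
      then show "Transposition.transpose (Suc (Suc i)) (Suc (Suc (Suc i))) \<in> T"
        using comp inv gens(2) Suc i by auto
    qed
  qed
  have id: "id \<in> T" using T.one_closed by (simp add: sym_group_one)
  have seq: "apply_adj_transps xs \<in> T" if "set xs \<subseteq> {1..<k}" for xs
    using that
  proof (induction xs)
    case (Cons x xs)
    then have "Transposition.transpose x (x + 1) \<in> T" using adj[of "x - 1"] by auto
    then show ?case using Cons comp unfolding apply_adj_transps_Cons by (metis insert_subset list.simps(15))
  qed (simp add: id)
  have less: "Transposition.transpose a b \<in> T" if "a \<in> {1..k}" "b \<in> {1..k}" "a < b" for a b
    using seq[of "adj_transp_seq a b"] that by (simp add: adj_transp_seq_correct set_adj_transp_seq)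
  have tr: "Transposition.transpose a b \<in> T" if "a \<in> {1..k}" "b \<in> {1..k}" "a \<noteq> b" for a b
    using less[of a b] less[of b a] that by (metis linorder_neqE_nat transpose_commute)
  have "p \<in> T" if "p permutes {1..k}" for p
    using that finite_atLeastAtMost by (induction rule: permutes_induct) (rule id, rule comp[OF tr])
  then show ?thesis using T.subset by (auto simp: sym_group_carrier)
qed

text \<open>The Heisenberg group over \<open>\<int>/r\<close> acts on \<open>(\<int>/r)\<^sup>2\<close> by \<open>(i, j) \<mapsto> (i + a, j + b + c i)\<close>;
  the point \<open>(i, j)\<close> is coded as \<open>1 + i + r j\<close>.\<close>

definition heisenberg_perm :: "nat \<Rightarrow> nat \<Rightarrow> nat \<Rightarrow> nat \<Rightarrow> nat \<Rightarrow> nat" where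
  "heisenberg_perm r a b c x = (if x \<in> {1..r * r}
     then 1 + ((x - 1) mod r + a) mod r + r * (((x - 1) div r + b + c * ((x - 1) mod r)) mod r) else x)"

lemma heisenberg_code:
  fixes x r :: nat
  assumes "x \<in> {1..r * r}"
  obtains i j where "i < r" "j < r" "x = 1 + i + r * j"
proof
  show "(x - 1) mod r < r" using assms by (cases r) auto
  show "(x - 1) div r < r" using assms by (intro less_mult_imp_div_less) auto
  show "x = 1 + (x - 1) mod r + r * ((x - 1) div r)" using assms by auto
qed

lemma heisenberg_code_bound:
  assumes "i < r" "j < (r::nat)"
  shows "1 + i + r * j \<in> {1..r * r}"
proof -
  have "r * j + r \<le> r * r" using assms(2) by (metis Suc_leI add.commute mult_Suc_right mult_le_mono2)
  then show ?thesis using assms(1) by simp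
qed

lemma heisenberg_perm_apply:
  assumes "i < r" "j < r"
  shows "heisenberg_perm r a b c (1 + i + r * j) = 1 + (i + a) mod r + r * ((j + b + c * i) mod r)"
  using heisenberg_code_bound[OF assms] assms by (simp add: heisenberg_perm_def)

text \<open>The term \<open>c' * a\<close> in the middle parameter is the source of
  noncommutativity.\<close>

lemma heisenberg_perm_comp:
  "heisenberg_perm r a' b' c' \<circ> heisenberg_perm r a b c = heisenberg_perm r (a + a') (b + b' + c' * a) (c + c')"
proof
  fix x
  show "(heisenberg_perm r a' b' c' \<circ> heisenberg_perm r a b c) x =
      heisenberg_perm r (a + a') (b + b' + c' * a) (c + c') x"
  proof (cases "x \<in> {1..r * r}")
    case True
    then obtain i j where ij: "i < r" "j < r" "x = 1 + i + r * j" by (rule heisenberg_code)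
    then have r: "(i + a) mod r < r" "(j + b + c * i) mod r < r" by auto
    have 1: "((i + a) mod r + a') mod r = (i + (a + a')) mod r"
      by (simp add: mod_add_left_eq add.assoc)
    have "((j + b + c * i) mod r + b' + c' * ((i + a) mod r)) mod r
        = ((j + b + c * i) + b' + c' * (i + a)) mod r"
      by (intro mod_add_cong mod_mult_cong) auto
    also have "(j + b + c * i) + b' + c' * (i + a) = j + (b + b' + c' * a) + (c + c') * i"
      by (simp add: algebra_simps)
    finally have 2: "((j + b + c * i) mod r + b' + c' * ((i + a) mod r)) mod r
        = (j + (b + b' + c' * a) + (c + c') * i) mod r" .
    show ?thesis
      unfolding o_apply ij(3) heisenberg_perm_apply[OF ij(1,2)] heisenberg_perm_apply[OF r] 1 2 ..
  next
    case False
    then have "heisenberg_perm r a b c x = x" for a b c unfolding heisenberg_perm_def by (rule if_not_P)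
    then show ?thesis by simp
  qed
qed

lemma heisenberg_perm_zero:
  assumes "r dvd a" "r dvd b" "r dvd c"
  shows "heisenberg_perm r a b c = id"
proof
  fix x
  show "heisenberg_perm r a b c x = id x"
  proof (cases "x \<in> {1..r * r}")
    case True
    then obtain i j where ij: "i < r" "j < r" "x = 1 + i + r * j" by (rule heisenberg_code)
    have "(i + a) mod r = i" "(j + b + c * i) mod r = j"
      using assms ij by (auto elim!: dvdE simp: mult.assoc)
    then show ?thesis unfolding ij(3) heisenberg_perm_apply[OF ij(1,2)] by simp
  next
    case False
    then show ?thesis by (auto simp: heisenberg_perm_def)
  qed
qed

lemma heisenberg_perm_inverse:
  assumes "0 < r"
  shows "\<exists>a' b' c'. heisenberg_perm r a' b' c' \<circ> heisenberg_perm r a b c = id"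
proof -
  \<comment> \<open>Multiplication by \<open>r - 1\<close> serves as negation modulo
    \<open>r\<close> on the naturals. The middle parameter of the inverse must also cancel the twist
    \<open>?c * a\<close>.\<close>
  have *: "r dvd x + (r - 1) * x" for x using assms by (metis Suc_diff_1 dvd_triv_left mult_Suc)
  let ?c = "(r - 1) * c"
  have "r dvd b + (r - 1) * (b + ?c * a) + ?c * a" using *[of "b + ?c * a"] by (simp add: ac_simps)
  then have "heisenberg_perm r ((r - 1) * a) ((r - 1) * (b + ?c * a)) ?c \<circ> heisenberg_perm r a b c = id"
    unfolding heisenberg_perm_comp using *[of a] *[of c] by (intro heisenberg_perm_zero)
  then show ?thesis by blast
qed

lemma heisenberg_perm_mod:
  "heisenberg_perm r (a mod r) (b mod r) (c mod r) = heisenberg_perm r a b c"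
proof
  fix x
  have "((x - 1) div r + b mod r + c mod r * ((x - 1) mod r)) mod r
      = ((x - 1) div r + b + c * ((x - 1) mod r)) mod r"
    by (intro mod_add_cong mod_mult_cong) auto
  then show "heisenberg_perm r (a mod r) (b mod r) (c mod r) x = heisenberg_perm r a b c x"
    by (simp add: heisenberg_perm_def mod_add_right_eq)
qed

text \<open>The Heisenberg group over \<int>/r acts faithfully on r^2 points, which fit into
  \<open>{1..k}\<close>; for prime \<open>r\<close> it is a nonabelian
  \<open>r\<close>-group.\<close>

lemma sym_group_heisenberg_subgroup:
  assumes r: "2 \<le> r" and k: "r * r \<le> k"
  shows "\<exists>R u v. subgroup R (sym_group k) \<and> card R = r ^ 3 \<and> u \<in> R \<and> v \<in> R \<and> u \<circ> v \<noteq> v \<circ> u"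
proof -
  let ?h = "heisenberg_perm r"
  define R where "R = {?h a b c | a b c. True}"
  have perm: "?h a b c permutes {1..k}" for a b c
  proof -
    have "inj (?h a b c)"
    proof -
      obtain h where h: "h \<circ> ?h a b c = id" using heisenberg_perm_inverse[of r a b c] r by auto
      show ?thesis by (rule inj_on_imageI2[of h]) (simp add: h)
    qed
    moreover have "?h a b c x \<in> {1..r * r}" if xr: "x \<in> {1..r * r}" for x
    proof -
      obtain i j where ij: "i < r" "j < r" "x = 1 + i + r * j" using heisenberg_code[OF xr] by metis
      show ?thesis unfolding ij(3) heisenberg_perm_apply[OF ij(1,2)]
        by (rule heisenberg_code_bound) (use ij in auto)
    qed
    ultimately have "?h a b c permutes {1..r * r}"
      by (intro inj_imp_permutes) (auto simp: heisenberg_perm_def intro: inj_on_subset)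
    then show ?thesis using k by (elim permutes_subset) auto
  qed
  interpret S: group "sym_group k" by (rule sym_group_is_group)
  have sub: "subgroup R (sym_group k)"
  proof (rule S.subgroupI)
    show "R \<subseteq> carrier (sym_group k)" using perm by (auto simp: R_def sym_group_carrier)
    show "R \<noteq> {}" by (auto simp: R_def)
  next
    fix p assume "p \<in> R"
    then obtain a b c where p: "p = ?h a b c" by (auto simp: R_def)
    obtain a' b' c' where inv: "?h a' b' c' \<circ> ?h a b c = id" using heisenberg_perm_inverse[of r a b c] r by auto
    have "inv\<^bsub>sym_group k\<^esub> p = ?h a' b' c'"
      using inv perm by (intro S.inv_equality) (auto simp: sym_group_carrier sym_group_mult sym_group_one p)
    then show "inv\<^bsub>sym_group k\<^esub> p \<in> R" by (auto simp: R_def)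
  next
    fix p q assume "p \<in> R" "q \<in> R"
    then show "p \<otimes>\<^bsub>sym_group k\<^esub> q \<in> R"
      by (auto simp: R_def sym_group_mult heisenberg_perm_comp) blast
  qed
  let ?D = "{0..<r} \<times> {0..<r} \<times> {0..<r}"
  let ?f = "\<lambda>(a, b, c). ?h a b c"
  have "R = ?f ` ?D"
  proof
    show "R \<subseteq> ?f ` ?D"
    proof
      fix p assume "p \<in> R"
      then obtain a b c where "p = ?h a b c" by (auto simp: R_def)
      then have "p = ?f (a mod r, b mod r, c mod r)" by (simp add: heisenberg_perm_mod)
      moreover have "(a mod r, b mod r, c mod r) \<in> ?D" using r by simp
      ultimately show "p \<in> ?f ` ?D" by (rule image_eqI)
    qed
  qed (auto simp: R_def)
  moreover have "a = a' \<and> b = b' \<and> c = c'"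
    if lt: "a < r" "b < r" "c < r" "a' < r" "b' < r" "c' < r" and eq: "?h a b c = ?h a' b' c'"
    for a b c a' b' c'
  proof -
    have dec: "i = i' \<and> j = j'" if "i < r" "i' < r" "1 + i + r * j = 1 + i' + r * j'" for i i' j j'
    proof -
      have "(i + r * j) mod r = (i' + r * j') mod r" "(i + r * j) div r = (i' + r * j') div r"
        using that by auto
      then show ?thesis using that by simp
    qed
    have r0: "0 < r" "1 < r" using r by auto
    \<comment> \<open>The image of the point (0, 0) reveals \<open>a\<close> and \<open>b\<close>;
      the image of (1, 0) then reveals \<open>c\<close>.\<close>
    have "a = a' \<and> b = b'"
      using fun_cong[OF eq, of "1 + 0 + r * 0"] dec[of a a' b b'] lt
      unfolding heisenberg_perm_apply[OF r0(1,1)] by simp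
    moreover have "(0 + b + c * 1) mod r = (0 + b' + c' * 1) mod r"
      using fun_cong[OF eq, of "1 + 1 + r * 0"] dec[of "(1 + a) mod r" "(1 + a') mod r"
          "(0 + b + c * 1) mod r" "(0 + b' + c' * 1) mod r"] r0
      unfolding heisenberg_perm_apply[OF r0(2,1)] by simp
    ultimately have "(b + c) mod r = (b + c') mod r" by simp
    then have "[b + c = b + c'] (mod r)" by (simp add: cong_def)
    then have "[c = c'] (mod r)" using cong_add_lcancel_nat by blast
    then show "a = a' \<and> b = b' \<and> c = c'"
      using \<open>a = a' \<and> b = b'\<close> lt by (auto simp: cong_def)
  qed
  then have "inj_on ?f ?D" by (intro inj_onI) force
  ultimately have card: "card R = r ^ 3" by (simp add: card_image power3_eq_cube)
  \<comment> \<open>The two products have middle parameters 0 and 1, which is visible at the point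
    (0, 0).\<close>
  have "?h 1 0 0 \<circ> ?h 0 0 1 \<noteq> ?h 0 0 1 \<circ> ?h 1 0 0"
  proof
    assume "?h 1 0 0 \<circ> ?h 0 0 1 = ?h 0 0 1 \<circ> ?h 1 0 0"
    then have "?h 1 0 1 (1 + 0 + r * 0) = ?h 1 1 1 (1 + 0 + r * 0)" by (simp add: heisenberg_perm_comp)
    then show False using r by (subst (asm) (1 2) heisenberg_perm_apply) auto
  qed
  moreover have "?h 1 0 0 \<in> R" "?h 0 0 1 \<in> R" by (auto simp: R_def)
  ultimately show ?thesis using sub card by blast
qed

section \<open>Homomorphisms from free groups\<close>

text \<open>The homomorphism of the universal property. The assignment \<open>g\<close> is total, so
  the lemmas about it need not mention a basis.\<close>

definition word_eval :: "('q, 'e) monoid_scheme \<Rightarrow> ('a \<Rightarrow> 'q) \<Rightarrow> 'a letter list \<Rightarrow> 'q" where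
  "word_eval Q g w = foldr (\<lambda>a q. (if snd a then g (fst a) else inv\<^bsub>Q\<^esub> (g (fst a))) \<otimes>\<^bsub>Q\<^esub> q) w \<one>\<^bsub>Q\<^esub>"

context group
begin

lemma word_eval_closed: "(\<And>x. g x \<in> carrier G) \<Longrightarrow> word_eval G g w \<in> carrier G"
  by (induction w) (auto simp: word_eval_def)

text \<open>A cancelled pair of letters contributes an element times its inverse, so free reduction
  does not change the value.\<close>

lemma word_eval_cancel_cons:
  assumes g: "\<And>x. g x \<in> carrier G"
  shows "word_eval G g (cancel_cons a w) =
    (if snd a then g (fst a) else inv (g (fst a))) \<otimes> word_eval G g w"
proof (cases w)
  case (Cons b w')
  have "word_eval G g w' \<in> carrier G" using word_eval_closed g by blast
  then show ?thesis
    using g Cons by (auto simp: word_eval_def inv_letter_def m_assoc[symmetric])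
qed (simp add: word_eval_def)

lemma word_eval_red_mult:
  assumes g: "\<And>x. g x \<in> carrier G"
  shows "word_eval G g (red_mult u v) = word_eval G g u \<otimes> word_eval G g v"
proof (induction u)
  case Nil
  show ?case using l_one[OF word_eval_closed[of g v]] g by (simp add: word_eval_def red_mult_def)
next
  case (Cons a u)
  have "word_eval G g (red_mult (a # u) v) =
      (if snd a then g (fst a) else inv (g (fst a))) \<otimes> word_eval G g (red_mult u v)"
    unfolding red_mult_def using word_eval_cancel_cons[of g, OF g] by simp
  also have "\<dots> = (if snd a then g (fst a) else inv (g (fst a))) \<otimes> word_eval G g u \<otimes> word_eval G g v"
    unfolding Cons using g word_eval_closed[of g, OF g] by (simp add: m_assoc)
  finally show ?case by (simp add: word_eval_def)
qed

lemma word_eval_hom: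
  assumes "\<And>x. g x \<in> carrier G"
  shows "word_eval G g \<in> hom (free_group X) G"
  using assms by (intro homI) (auto simp: word_eval_closed word_eval_red_mult free_group_def)

end

section \<open>Free groups of rank at most one are abelian\<close>

text \<open>Two letters on the same generator are equal or mutually inverse, and in the second case
  both sides reduce to \<open>w\<close>.\<close>

lemma cancel_cons_commute:
  assumes "fst a = fst b" "reduced w"
  shows "cancel_cons a (cancel_cons b w) = cancel_cons b (cancel_cons a w)"
proof (cases "a = b")
  case False
  then have "b = inv_letter a" using assms(1) by (cases a; cases b) (auto simp: inv_letter_def)
  then show ?thesis
    using cancel_cons_inverse[OF assms(2), of a] cancel_cons_inverse[OF assms(2), of b] by simp
qed simp

lemma red_mult_single_generator_commute:
  assumes "set u \<subseteq> {x} \<times> UNIV" "set v \<subseteq> {x} \<times> UNIV" "reduced u" "reduced v"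
  shows "red_mult u v = red_mult v u"
  using assms(1,3)
proof (induction u)
  case Nil
  then show ?case using red_mult_Nil[OF assms(4)] by (simp add: red_mult_def)
next
  case (Cons a u)
  have u: "reduced u" "set u \<subseteq> {x} \<times> UNIV" and a: "fst a = x" using Cons.prems by (auto simp: reduced_Cons)
  have swap: "red_mult v (cancel_cons a w) = cancel_cons a (red_mult v w)"
    if "reduced w" for w
    using assms(2)
  proof (induction v)
    case (Cons b v)
    then have "fst b = fst a" using a by auto
    then show ?case using Cons cancel_cons_commute reduced_red_mult[OF that, of v]
      by (simp add: red_mult_def)
  qed (simp add: red_mult_def)
  have "a # u = cancel_cons a u" using Cons.prems(2) by (cases u) (auto simp: reduced_Cons)
  then have "red_mult v (a # u) = cancel_cons a (red_mult v u)" using swap[OF u(1)] by simp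
  then show ?case using Cons.IH[OF u(2,1)] by (simp add: red_mult_def)
qed

lemma free_group_noncommutative_generators:
  assumes "\<not> comm_group (free_group X)"
  shows "\<exists>x\<in>X. \<exists>y\<in>X. x \<noteq> y"
proof (rule ccontr)
  assume no: "\<not> ?thesis"
  then obtain x where x: "X \<subseteq> {x}" by (cases "X = {}") auto
  have "comm_group (free_group X)"
  proof (rule group.group_comm_groupI[OF group_free_group])
    fix u v assume "u \<in> carrier (free_group X)" "v \<in> carrier (free_group X)"
    then have "set u \<subseteq> {x} \<times> UNIV" "set v \<subseteq> {x} \<times> UNIV" "reduced u" "reduced v"
      using x by (auto simp: free_group_def)
    then show "u \<otimes>\<^bsub>free_group X\<^esub> v = v \<otimes>\<^bsub>free_group X\<^esub> u"
      using red_mult_single_generator_commute by (simp add: free_group_def)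
  qed
  then show False using assms by blast
qed

lemma nonabelian_free_group_hom:
  fixes F :: "('f, 'd) monoid_scheme"
  assumes F: "is_free_group F" "\<not> comm_group F" and Q: "group Q"
    and st: "s \<in> carrier Q" "t \<in> carrier Q"
  shows "\<exists>\<psi> \<in> hom F Q. s \<in> \<psi> ` carrier F \<and> t \<in> \<psi> ` carrier F"
proof -
  interpret F: group F using F(1) by (simp add: is_free_group_def)
  interpret Q: group Q by fact
  obtain X :: "'f set" and h where h: "h \<in> iso F (free_group X)"
    using F(1) by (auto simp: is_free_group_def is_iso_def)
  interpret X: group "free_group X" by (rule group_free_group)
  have "\<not> comm_group (free_group X)"
  proof
    assume "comm_group (free_group X)"
    then have "comm_group F"
      by (rule comm_group.iso_imp_comm_group[OF _ F.iso_sym[OF is_isoI[OF h]] F.monoid_axioms])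
    then show False using F(2) by blast
  qed
  then obtain x y where xy: "x \<in> X" "y \<in> X" "x \<noteq> y"
    using free_group_noncommutative_generators by blast
  \<comment> \<open>Two distinct generators take the values \<open>s\<close> and \<open>t\<close>;
    all others are sent to the identity.\<close>
  define g where "g z = (if z = x then s else if z = y then t else \<one>\<^bsub>Q\<^esub>)" for z
  have g: "g z \<in> carrier Q" for z using st by (simp add: g_def)
  let ?e = "word_eval Q g"
  have e: "?e \<in> hom (free_group X) Q" using Q.word_eval_hom g by blast
  have mem: "[(x, True)] \<in> carrier (free_group X)" "[(y, True)] \<in> carrier (free_group X)"
    using xy by (auto simp: free_group_def reduced_Cons)
  have val: "?e [(x, True)] = s" "?e [(y, True)] = t"
    using xy st by (auto simp: word_eval_def g_def)
  have hsurj: "h ` carrier F = carrier (free_group X)" using h by (simp add: iso_def bij_betw_def)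
  have img: "(?e \<circ> h) ` carrier F = ?e ` carrier (free_group X)"
    unfolding image_comp[symmetric] hsurj ..
  have "?e \<circ> h \<in> hom F Q" using h e by (intro hom_compose) (auto simp: iso_def)
  moreover have "s \<in> (?e \<circ> h) ` carrier F" unfolding img using mem(1) val(1) by (metis imageI)
  moreover have "t \<in> (?e \<circ> h) ` carrier F" unfolding img using mem(2) val(2) by (metis imageI)
  ultimately show ?thesis by blast
qed

section \<open>Integer matrices modulo an integer\<close>

text \<open>The full matrix ring over \<int>/m, sharing carrier and product with
  \<open>monoid_mat_mod\<close> so that its unit group is \<open>GL_mod\<close>.\<close>

definition ring_mat_mod :: "nat \<Rightarrow> nat \<Rightarrow> int mat ring" where
  "ring_mat_mod n m = \<lparr>carrier = carrier (monoid_mat_mod n m),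
     monoid.mult = (\<lambda>A B. mat_mod m (A * B)), one = mat_mod m (1\<^sub>m n),
     zero = 0\<^sub>m n n, add = (\<lambda>A B. mat_mod m (A + B))\<rparr>"

lemma ring_mat_mod_simps [simp]:
  "carrier (ring_mat_mod n m) = carrier (monoid_mat_mod n m)"
  "A \<otimes>\<^bsub>ring_mat_mod n m\<^esub> B = mat_mod m (A * B)"
  "\<one>\<^bsub>ring_mat_mod n m\<^esub> = mat_mod m (1\<^sub>m n)"
  "\<zero>\<^bsub>ring_mat_mod n m\<^esub> = 0\<^sub>m n n"
  "A \<oplus>\<^bsub>ring_mat_mod n m\<^esub> B = mat_mod m (A + B)"
  by (simp_all add: ring_mat_mod_def)

lemma mat_mod_add_left:
  assumes "A \<in> carrier_mat n n" "B \<in> carrier_mat n n"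
  shows "mat_mod m (mat_mod m A + B) = mat_mod m (A + B)"
  using assms by (intro eq_matI) (auto simp: mat_mod_def mod_add_left_eq)

lemma mat_mod_add_right:
  assumes "A \<in> carrier_mat n n" "B \<in> carrier_mat n n"
  shows "mat_mod m (A + mat_mod m B) = mat_mod m (A + B)"
  using assms by (intro eq_matI) (auto simp: mat_mod_def mod_add_right_eq)

lemma mat_mod_mult_left:
  assumes "A \<in> carrier_mat n n" "B \<in> carrier_mat n n"
  shows "mat_mod m (mat_mod m A * B) = mat_mod m (A * B)"
  using assms by (intro mat_mod_mult_aux[of _ n]) auto

lemma mat_mod_mult_right:
  assumes "A \<in> carrier_mat n n" "B \<in> carrier_mat n n"
  shows "mat_mod m (A * mat_mod m B) = mat_mod m (A * B)"
  using assms by (intro mat_mod_mult_aux[of _ n]) auto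

lemma monoid_mat_mod_carrierD:
  assumes "A \<in> carrier (monoid_mat_mod n m)"
  shows "A \<in> carrier_mat n n" "mat_mod m A = A"
  using assms by (auto simp: monoid_mat_mod_def mat_mod_eq)

lemma ring_ring_mat_mod:
  assumes m: "m > 0"
  shows "ring (ring_mat_mod n m)"
proof (rule ringI)
  have closed: "mat_mod m A \<in> carrier (monoid_mat_mod n m)" if "A \<in> carrier_mat n n" for A
    using mat_mod_closed[OF m that] .
  show "abelian_group (ring_mat_mod n m)"
  proof (rule abelian_groupI)
    fix A assume A: "A \<in> carrier (ring_mat_mod n m)"
    then have A': "A \<in> carrier_mat n n" "mat_mod m A = A" by (simp_all add: monoid_mat_mod_carrierD)
    show "\<zero>\<^bsub>ring_mat_mod n m\<^esub> \<oplus>\<^bsub>ring_mat_mod n m\<^esub> A = A" using A' by simp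
    have "mat_mod m (mat_mod m (- A) + A) = 0\<^sub>m n n"
      using A' by (subst mat_mod_add_left[of _ n]) (auto simp: mat_mod_def intro!: eq_matI)
    moreover have "mat_mod m (- A) \<in> carrier (monoid_mat_mod n m)" using A' by (intro closed) simp
    ultimately show "\<exists>B\<in>carrier (ring_mat_mod n m). B \<oplus>\<^bsub>ring_mat_mod n m\<^esub> A = \<zero>\<^bsub>ring_mat_mod n m\<^esub>"
      by auto
  next
    have "mat_mod m (0\<^sub>m n n) = 0\<^sub>m n n" by (auto simp: mat_mod_def intro!: eq_matI)
    then show "\<zero>\<^bsub>ring_mat_mod n m\<^esub> \<in> carrier (ring_mat_mod n m)" using closed[of "0\<^sub>m n n"] by simp
  next
    fix A B assume "A \<in> carrier (ring_mat_mod n m)" "B \<in> carrier (ring_mat_mod n m)"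
    then have AB: "A \<in> carrier_mat n n" "B \<in> carrier_mat n n" by (simp_all add: monoid_mat_mod_carrierD)
    then show "A \<oplus>\<^bsub>ring_mat_mod n m\<^esub> B \<in> carrier (ring_mat_mod n m)" using closed by simp
    show "A \<oplus>\<^bsub>ring_mat_mod n m\<^esub> B = B \<oplus>\<^bsub>ring_mat_mod n m\<^esub> A" using AB comm_add_mat[OF AB] by simp
    fix C assume "C \<in> carrier (ring_mat_mod n m)"
    then have C: "C \<in> carrier_mat n n" by (simp_all add: monoid_mat_mod_carrierD)
    show "(A \<oplus>\<^bsub>ring_mat_mod n m\<^esub> B) \<oplus>\<^bsub>ring_mat_mod n m\<^esub> C = A \<oplus>\<^bsub>ring_mat_mod n m\<^esub> (B \<oplus>\<^bsub>ring_mat_mod n m\<^esub> C)"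
      using AB C assoc_add_mat[OF AB C]
      by (simp add: mat_mod_add_left[of "A + B" n C] mat_mod_add_right[of A n "B + C"])
  qed
  interpret M: Group.monoid "monoid_mat_mod n m" by (rule monoid_monoid_mat_mod[OF m])
  have eq: "A \<otimes>\<^bsub>ring_mat_mod n m\<^esub> B = A \<otimes>\<^bsub>monoid_mat_mod n m\<^esub> B"
    "\<one>\<^bsub>ring_mat_mod n m\<^esub> = \<one>\<^bsub>monoid_mat_mod n m\<^esub>" for A B
    by (simp_all add: monoid_mat_mod_def)
  show "Group.monoid (ring_mat_mod n m)"
    by (rule monoidI, unfold eq ring_mat_mod_simps(1))
      (rule M.m_closed M.one_closed M.m_assoc M.l_one M.r_one; assumption)+
next
  fix A B C
  assume "A \<in> carrier (ring_mat_mod n m)" "B \<in> carrier (ring_mat_mod n m)" "C \<in> carrier (ring_mat_mod n m)"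
  then have c: "A \<in> carrier_mat n n" "B \<in> carrier_mat n n" "C \<in> carrier_mat n n"
    by (simp_all add: monoid_mat_mod_carrierD)
  show "(A \<oplus>\<^bsub>ring_mat_mod n m\<^esub> B) \<otimes>\<^bsub>ring_mat_mod n m\<^esub> C =
      A \<otimes>\<^bsub>ring_mat_mod n m\<^esub> C \<oplus>\<^bsub>ring_mat_mod n m\<^esub> B \<otimes>\<^bsub>ring_mat_mod n m\<^esub> C"
    using c by (simp add: mat_mod_mult_left[of _ n] mat_mod_add_left[of _ n] mat_mod_add_right[of _ n]
        add_mult_distrib_mat[of _ n n])
  show "C \<otimes>\<^bsub>ring_mat_mod n m\<^esub> (A \<oplus>\<^bsub>ring_mat_mod n m\<^esub> B) =
      C \<otimes>\<^bsub>ring_mat_mod n m\<^esub> A \<oplus>\<^bsub>ring_mat_mod n m\<^esub> C \<otimes>\<^bsub>ring_mat_mod n m\<^esub> B"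
    using c by (simp add: mat_mod_mult_right[of _ n] mat_mod_add_left[of _ n] mat_mod_add_right[of _ n]
        mult_add_distrib_mat[of _ n n])
qed

lemma ring_mat_mod_char: "[int m] \<cdot>\<^bsub>ring_mat_mod n m\<^esub> \<one>\<^bsub>ring_mat_mod n m\<^esub> = \<zero>\<^bsub>ring_mat_mod n m\<^esub>"
proof -
  have "[(k::nat)] \<cdot>\<^bsub>ring_mat_mod n m\<^esub> \<one>\<^bsub>ring_mat_mod n m\<^esub> = mat_mod m (int k \<cdot>\<^sub>m 1\<^sub>m n)" for k
  proof (induction k)
    case 0
    show ?case by (auto simp: add_pow_def nat_pow_def mat_mod_def intro!: eq_matI)
  next
    case (Suc k)
    have "[Suc k] \<cdot>\<^bsub>ring_mat_mod n m\<^esub> \<one>\<^bsub>ring_mat_mod n m\<^esub> = mat_mod m (mat_mod m (int k \<cdot>\<^sub>m 1\<^sub>m n) + mat_mod m (1\<^sub>m n))"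
      using Suc by (simp add: add_pow_def nat_pow_def)
    also have "\<dots> = mat_mod m (int k \<cdot>\<^sub>m 1\<^sub>m n + 1\<^sub>m n)"
      by (simp add: mat_mod_add_left[of _ n] mat_mod_add_right[of _ n])
    also have "int k \<cdot>\<^sub>m 1\<^sub>m n + 1\<^sub>m n = int (Suc k) \<cdot>\<^sub>m (1\<^sub>m n :: int mat)"
      by (auto intro!: eq_matI simp: algebra_simps)
    finally show ?case .
  qed
  moreover have "mat_mod m (int m \<cdot>\<^sub>m 1\<^sub>m n) = 0\<^sub>m n n" by (auto simp: mat_mod_def intro!: eq_matI)
  ultimately show ?thesis by (simp add: add_pow_def int_pow_int)
qed

text \<open>A matrix is determined by its \<open>n * n\<close> entries, each one of \<open>m\<close>
  residues. For prime \<open>m\<close> the exponent becomes the degree bound in the counting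
  argument.\<close>

lemma monoid_mat_mod_card:
  "finite (carrier (monoid_mat_mod n m))" "card (carrier (monoid_mat_mod n m)) \<le> m ^ (n * n)"
proof -
  let ?I = "{0..<n} \<times> {0..<n}"
  let ?f = "\<lambda>A :: int mat. \<lambda>ij \<in> ?I. A $$ ij"
  have inj: "inj_on ?f (carrier (monoid_mat_mod n m))"
  proof (rule inj_onI)
    fix A B assume AB: "A \<in> carrier (monoid_mat_mod n m)" "B \<in> carrier (monoid_mat_mod n m)" "?f A = ?f B"
    show "A = B"
    proof (rule eq_matI)
      fix i j assume "i < dim_row B" "j < dim_col B"
      then show "A $$ (i, j) = B $$ (i, j)"
        using fun_cong[OF AB(3), of "(i, j)"] monoid_mat_mod_carrierD(1)[OF AB(2)] by auto
    qed (use monoid_mat_mod_carrierD(1)[OF AB(1)] monoid_mat_mod_carrierD(1)[OF AB(2)] in auto)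
  qed
  have sub: "?f ` carrier (monoid_mat_mod n m) \<subseteq> ?I \<rightarrow>\<^sub>E {0..<int m}"
  proof (intro image_subsetI PiE_I)
    fix A ij assume A: "A \<in> carrier (monoid_mat_mod n m)" and "ij \<in> ?I"
    then have "A $$ ij \<in> elements_mat A" using monoid_mat_mod_carrierD(1)[OF A] by (cases ij) auto
    then have "A $$ ij \<in> {0..<int m}" using A by (auto simp: monoid_mat_mod_def)
    then show "?f A ij \<in> {0..<int m}" using \<open>ij \<in> ?I\<close> by simp
  qed simp
  have fin: "finite (?I \<rightarrow>\<^sub>E {0..<int m})" by (intro finite_PiE) auto
  show "finite (carrier (monoid_mat_mod n m))" using inj_on_finite[OF inj sub fin] .
  have "card (?I \<rightarrow>\<^sub>E {0..<int m}) = m ^ (n * n)" by (simp add: card_PiE card_cartesian_product)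
  then show "card (carrier (monoid_mat_mod n m)) \<le> m ^ (n * n)"
    using card_inj_on_le[OF inj sub fin] by simp
qed

section \<open>Matrices congruent to the identity\<close>

lemma mat_mod_eq_oneD:
  assumes A: "A \<in> carrier_mat n n" and "mat_mod a A = mat_mod a (1\<^sub>m n)"
  shows "\<exists>X \<in> carrier_mat n n. A = 1\<^sub>m n + int a \<cdot>\<^sub>m X"
proof (intro bexI)
  let ?X = "mat n n (\<lambda>ij. (A $$ ij - 1\<^sub>m n $$ ij) div int a)"
  show "?X \<in> carrier_mat n n" by simp
  show "A = 1\<^sub>m n + int a \<cdot>\<^sub>m ?X"
  proof (rule eq_matI)
    fix i j assume "i < dim_row (1\<^sub>m n + int a \<cdot>\<^sub>m ?X)" "j < dim_col (1\<^sub>m n + int a \<cdot>\<^sub>m ?X)"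
    then have ij: "i < n" "j < n" by auto
    have "A $$ (i, j) mod int a = (1\<^sub>m n) $$ (i, j) mod int a"
      using arg_cong[OF assms(2), of "\<lambda>M. M $$ (i, j)"] ij A by (simp add: mat_mod_def)
    then have "int a dvd A $$ (i, j) - (1\<^sub>m n) $$ (i, j)" by (simp add: mod_eq_dvd_iff)
    then have "A $$ (i, j) = (1\<^sub>m n) $$ (i, j) + int a * ((A $$ (i, j) - (1\<^sub>m n) $$ (i, j)) div int a)" by simp
    then show "A $$ (i, j) = (1\<^sub>m n + int a \<cdot>\<^sub>m ?X) $$ (i, j)"
      using ij by (simp del: index_one_mat)
  qed (use A in auto)
qed

text \<open>Both products equal 1 + aX + bY up to a multiple of ab. The case \<open>a = b\<close> is
  included, so levels that are prime powers descend too.\<close>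

lemma congruent_one_commute:
  assumes A: "A \<in> carrier_mat n n" "mat_mod a A = mat_mod a (1\<^sub>m n)"
    and B: "B \<in> carrier_mat n n" "mat_mod b B = mat_mod b (1\<^sub>m n)"
  shows "mat_mod (a * b) (A * B) = mat_mod (a * b) (B * A)"
proof -
  obtain X Y where X: "X \<in> carrier_mat n n" "A = 1\<^sub>m n + int a \<cdot>\<^sub>m X"
    and Y: "Y \<in> carrier_mat n n" "B = 1\<^sub>m n + int b \<cdot>\<^sub>m Y"
    using mat_mod_eq_oneD[OF A] mat_mod_eq_oneD[OF B] by blast
  have expand: "(1\<^sub>m n + int c \<cdot>\<^sub>m U) * (1\<^sub>m n + int d \<cdot>\<^sub>m V)
      = 1\<^sub>m n + int d \<cdot>\<^sub>m V + (int c \<cdot>\<^sub>m U + (int c * int d) \<cdot>\<^sub>m (U * V))"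
    if U: "U \<in> carrier_mat n n" and V: "V \<in> carrier_mat n n" for c d U V
  proof -
    have "(1\<^sub>m n + int c \<cdot>\<^sub>m U) * (1\<^sub>m n + int d \<cdot>\<^sub>m V)
        = 1\<^sub>m n * (1\<^sub>m n + int d \<cdot>\<^sub>m V) + (int c \<cdot>\<^sub>m U) * (1\<^sub>m n + int d \<cdot>\<^sub>m V)"
      using U V by (intro add_mult_distrib_mat[of _ n n]) auto
    also have "(int c \<cdot>\<^sub>m U) * (1\<^sub>m n + int d \<cdot>\<^sub>m V) = (int c \<cdot>\<^sub>m U) * 1\<^sub>m n + (int c \<cdot>\<^sub>m U) * (int d \<cdot>\<^sub>m V)"
      using U V by (intro mult_add_distrib_mat[of _ n n]) auto
    also have "(int c \<cdot>\<^sub>m U) * (int d \<cdot>\<^sub>m V) = (int c * int d) \<cdot>\<^sub>m (U * V)"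
      using U V by (auto intro!: eq_matI simp: mult_smult_assoc_mat[of _ n n] mult_smult_distrib[of _ n n])
    finally show ?thesis using U V by simp
  qed
  have XY: "X * Y \<in> carrier_mat n n" "Y * X \<in> carrier_mat n n" using X Y by auto
  show ?thesis
  proof (rule eq_matI)
    fix i j assume "i < dim_row (mat_mod (a * b) (B * A))" "j < dim_col (mat_mod (a * b) (B * A))"
    then have ij: "i < n" "j < n" using A(1) B(1) by (auto simp: mat_mod_def)
    let ?e = "(1\<^sub>m n :: int mat) $$ (i, j) + int a * X $$ (i, j) + int b * Y $$ (i, j)"
    have "(A * B) $$ (i, j) = ?e + (int a * int b) * (X * Y) $$ (i, j)"
      unfolding X(2) Y(2) expand[OF X(1) Y(1)]
      using ij carrier_matD[OF X(1)] carrier_matD[OF Y(1)] carrier_matD[OF XY(1)]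
      by (simp del: index_mult_mat(1) index_one_mat)
    moreover have "(B * A) $$ (i, j) = ?e + (int a * int b) * (Y * X) $$ (i, j)"
      unfolding X(2) Y(2) expand[OF Y(1) X(1)]
      using ij carrier_matD[OF X(1)] carrier_matD[OF Y(1)] carrier_matD[OF XY(2)]
      by (simp del: index_mult_mat(1) index_one_mat)
    ultimately have "(A * B) $$ (i, j) mod int (a * b) = (B * A) $$ (i, j) mod int (a * b)"
      by (simp only: of_nat_mult mod_mult_self2)
    then show "mat_mod (a * b) (A * B) $$ (i, j) = mat_mod (a * b) (B * A) $$ (i, j)"
      using ij A(1) B(1) by (simp add: mat_mod_def del: index_mult_mat(1))
  qed (use A(1) B(1) in \<open>auto simp: mat_mod_def\<close>)
qed

section \<open>Congruence subgroups\<close>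

lemma GL_mod_simps:
  "carrier (GL_mod n m) = Units (monoid_mat_mod n m)"
  "A \<otimes>\<^bsub>GL_mod n m\<^esub> B = mat_mod m (A * B)"
  "\<one>\<^bsub>GL_mod n m\<^esub> = mat_mod m (1\<^sub>m n)"
  by (simp_all add: GL_mod_def units_of_carrier units_of_mult units_of_one monoid_mat_mod_def)

lemma finite_GL_mod: "finite (carrier (GL_mod n m))"
  unfolding GL_mod_simps by (rule finite_subset[OF _ monoid_mat_mod_card(1)]) (auto simp: Units_def)

text \<open>The ring theorem with \<open>N = n * n\<close> and \<open>q = r ^ e\<close>: the bound
  \<open>n * n < r\<close> makes every degree up to \<open>N\<close> prime to
  \<open>r\<close>.\<close>

lemma GL_mod_central_commutator_trivial:
  assumes p: "prime p" and r: "prime r" "r \<noteq> p" "n * n < r"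
    and x: "x \<in> carrier (GL_mod n p)" and y: "y \<in> carrier (GL_mod n p)" and z: "z \<in> carrier (GL_mod n p)"
    and yx: "y \<otimes>\<^bsub>GL_mod n p\<^esub> x = z \<otimes>\<^bsub>GL_mod n p\<^esub> x \<otimes>\<^bsub>GL_mod n p\<^esub> y"
    and zx: "z \<otimes>\<^bsub>GL_mod n p\<^esub> x = x \<otimes>\<^bsub>GL_mod n p\<^esub> z"
    and zy: "z \<otimes>\<^bsub>GL_mod n p\<^esub> y = y \<otimes>\<^bsub>GL_mod n p\<^esub> z"
    and z1: "z [^]\<^bsub>GL_mod n p\<^esub> (r ^ e) = \<one>\<^bsub>GL_mod n p\<^esub>"
  shows "z = \<one>\<^bsub>GL_mod n p\<^esub>"
proof -
  let ?R = "ring_mat_mod n p"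
  have units: "Units ?R = carrier (GL_mod n p)"
    unfolding GL_mod_simps by (simp add: Units_def) (simp add: monoid_mat_mod_def)
  have pow: "z [^]\<^bsub>GL_mod n p\<^esub> (k::nat) = z [^]\<^bsub>?R\<^esub> k" for k
    by (simp add: nat_pow_def GL_mod_simps)
  have "z = \<one>\<^bsub>?R\<^esub>"
  proof (rule ring.central_commutator_trivial[OF ring_ring_mat_mod[OF prime_gt_0_nat[OF p]],
        where p = p and N = "n * n" and q = "r ^ e" and x = x and y = y])
    show "finite (carrier ?R)" "card (carrier ?R) \<le> p ^ (n * n)" using monoid_mat_mod_card by simp_all
    show "prime p" by fact
    show "[int p] \<cdot>\<^bsub>?R\<^esub> \<one>\<^bsub>?R\<^esub> = \<zero>\<^bsub>?R\<^esub>" by (rule ring_mat_mod_char)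
    show "x \<in> Units ?R" "y \<in> Units ?R" using x y units by simp_all
    show "z \<in> carrier ?R" using z by (simp add: GL_mod_simps Units_def)
    show "z \<otimes>\<^bsub>?R\<^esub> x = x \<otimes>\<^bsub>?R\<^esub> z" "z \<otimes>\<^bsub>?R\<^esub> y = y \<otimes>\<^bsub>?R\<^esub> z"
      "y \<otimes>\<^bsub>?R\<^esub> x = z \<otimes>\<^bsub>?R\<^esub> x \<otimes>\<^bsub>?R\<^esub> y"
      using zx zy yx by (simp_all add: GL_mod_simps)
    show "z [^]\<^bsub>?R\<^esub> (r ^ e) = \<one>\<^bsub>?R\<^esub>" using z1 unfolding pow by (simp add: GL_mod_simps)
    show "coprime (r ^ e) p" using primes_coprime[OF r(1) p r(2)] by simp
    fix d :: nat assume "1 \<le> d" "d \<le> n * n"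
    then have "\<not> r dvd d" using r(3) by (auto dest: dvd_imp_le)
    then have "coprime r d" using r(1) prime_imp_coprime by blast
    then show "coprime d (r ^ e)" by (simp add: coprime_commute)
  qed
  then show ?thesis by (simp add: GL_mod_simps)
qed

text \<open>The index in \<open>G\<close> is at most the index of \<open>H\<close> times the order
  of \<open>Q\<close>; cosets of the kernel are counted directly by such pairs.\<close>

lemma finite_index_kernel:
  assumes G: "group G" and H: "finite_index_subgroup H G"
    and Q: "group Q" "finite (carrier Q)" and f: "f \<in> hom (G\<lparr>carrier := H\<rparr>) Q"
  shows "finite_index_subgroup {h \<in> H. f h = \<one>\<^bsub>Q\<^esub>} G"
proof -
  interpret G: group G by fact
  have sub: "subgroup H G" and fin: "finite (rcosets\<^bsub>G\<^esub> H)" using H by (auto simp: finite_index_subgroup_def)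
  interpret H: subgroup H G by fact
  interpret f: group_hom "G\<lparr>carrier := H\<rparr>" Q f
    using G.subgroup_imp_group[OF sub] Q(1) f by (intro group_hom.intro group_hom_axioms.intro)
  let ?K = "{h \<in> H. f h = \<one>\<^bsub>Q\<^esub>}"
  have inv: "inv\<^bsub>G\<lparr>carrier := H\<rparr>\<^esub> h = inv\<^bsub>G\<^esub> h" if "h \<in> H" for h
    using G.m_inv_consistent[OF sub that] .
  have mult: "f (a \<otimes>\<^bsub>G\<^esub> b) = f a \<otimes>\<^bsub>Q\<^esub> f b" if "a \<in> H" "b \<in> H" for a b
    using f.hom_mult[of a b] that by simp
  have finv: "f (inv\<^bsub>G\<^esub> a) = inv\<^bsub>Q\<^esub> (f a)" if "a \<in> H" for a
    using f.hom_inv[of a] that inv[OF that] by simp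
  have closed: "f a \<in> carrier Q" if "a \<in> H" for a using f.hom_closed[of a] that by simp
  have one: "f \<one>\<^bsub>G\<^esub> = \<one>\<^bsub>Q\<^esub>" using f.hom_one by simp
  have subK: "subgroup ?K G"
  proof (rule G.subgroupI)
    have "\<one>\<^bsub>G\<^esub> \<in> ?K" using one by simp
    then show "?K \<noteq> {}" by blast
  qed (auto simp: mult finv)
  \<comment> \<open>A coset of the kernel is determined by the coset of \<open>H\<close> containing it and one value of \<open>f\<close>.\<close>
  define t where "t C = (SOME t. t \<in> carrier G \<and> C = H #>\<^bsub>G\<^esub> t)" for C
  define S where "S = (\<lambda>(C, q). {x \<in> carrier G. x \<otimes>\<^bsub>G\<^esub> inv\<^bsub>G\<^esub> (t C) \<in> H \<and> f (x \<otimes>\<^bsub>G\<^esub> inv\<^bsub>G\<^esub> (t C)) = q})"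
  have "?K #>\<^bsub>G\<^esub> g \<in> S ` ((rcosets\<^bsub>G\<^esub> H) \<times> carrier Q)" if g: "g \<in> carrier G" for g
  proof -
    let ?t = "t (H #>\<^bsub>G\<^esub> g)"
    have t: "?t \<in> carrier G" "H #>\<^bsub>G\<^esub> g = H #>\<^bsub>G\<^esub> ?t"
      using someI[of "\<lambda>t. t \<in> carrier G \<and> H #>\<^bsub>G\<^esub> g = H #>\<^bsub>G\<^esub> t" g] g unfolding t_def by auto
    let ?b = "g \<otimes>\<^bsub>G\<^esub> inv\<^bsub>G\<^esub> ?t"
    have "g \<in> H #>\<^bsub>G\<^esub> ?t" using G.rcos_self[OF g sub] t(2) by simp
    then obtain h where h: "h \<in> H" "g = h \<otimes>\<^bsub>G\<^esub> ?t" unfolding r_coset_def by blast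
    have "?b = h \<otimes>\<^bsub>G\<^esub> ?t \<otimes>\<^bsub>G\<^esub> inv\<^bsub>G\<^esub> ?t" by (rule arg_cong[OF h(2)])
    also have "\<dots> = h" using h(1) t(1) by (simp add: G.m_assoc)
    finally have b: "?b \<in> H" using h(1) by simp
    have "?K #>\<^bsub>G\<^esub> g = S (H #>\<^bsub>G\<^esub> g, f ?b)"
    proof
      show "?K #>\<^bsub>G\<^esub> g \<subseteq> S (H #>\<^bsub>G\<^esub> g, f ?b)"
      proof
        fix x assume "x \<in> ?K #>\<^bsub>G\<^esub> g"
        then obtain k where k: "k \<in> H" "f k = \<one>\<^bsub>Q\<^esub>" "x = k \<otimes>\<^bsub>G\<^esub> g" unfolding r_coset_def by blast
        have "x \<otimes>\<^bsub>G\<^esub> inv\<^bsub>G\<^esub> ?t = k \<otimes>\<^bsub>G\<^esub> ?b" using k g t(1) by (simp add: G.m_assoc)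
        moreover have "f (k \<otimes>\<^bsub>G\<^esub> ?b) = f ?b" using mult[OF k(1) b] k(2) closed[OF b] f.H.l_one by simp
        ultimately show "x \<in> S (H #>\<^bsub>G\<^esub> g, f ?b)" unfolding S_def using k g b H.m_closed[OF k(1) b] by simp
      qed
      show "S (H #>\<^bsub>G\<^esub> g, f ?b) \<subseteq> ?K #>\<^bsub>G\<^esub> g"
      proof
        fix x assume "x \<in> S (H #>\<^bsub>G\<^esub> g, f ?b)"
        then have x: "x \<in> carrier G" and a: "x \<otimes>\<^bsub>G\<^esub> inv\<^bsub>G\<^esub> ?t \<in> H" "f (x \<otimes>\<^bsub>G\<^esub> inv\<^bsub>G\<^esub> ?t) = f ?b"
          unfolding S_def by auto
        let ?k = "(x \<otimes>\<^bsub>G\<^esub> inv\<^bsub>G\<^esub> ?t) \<otimes>\<^bsub>G\<^esub> inv\<^bsub>G\<^esub> ?b"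
        have "f ?k = \<one>\<^bsub>Q\<^esub>"
          using mult[OF a(1) H.m_inv_closed[OF b]] finv[OF b] a(2) closed[OF b] f.H.r_inv by simp
        moreover have "?k \<in> H" using a(1) b by simp
        moreover have "?k \<otimes>\<^bsub>G\<^esub> g = x"
          using x g t(1) by (simp add: G.inv_mult_group G.m_assoc)
        ultimately show "x \<in> ?K #>\<^bsub>G\<^esub> g" unfolding r_coset_def by blast
      qed
    qed
    moreover have "(H #>\<^bsub>G\<^esub> g, f ?b) \<in> (rcosets\<^bsub>G\<^esub> H) \<times> carrier Q"
      using g closed[OF b] by (auto simp: RCOSETS_def)
    ultimately show ?thesis by blast
  qed
  then have "rcosets\<^bsub>G\<^esub> ?K \<subseteq> S ` ((rcosets\<^bsub>G\<^esub> H) \<times> carrier Q)" unfolding RCOSETS_def by blast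
  then have "finite (rcosets\<^bsub>G\<^esub> ?K)" using fin Q(2) by (meson finite_SigmaI finite_imageI finite_subset)
  then show ?thesis using subK by (simp add: finite_index_subgroup_def)
qed

text \<open>If the least suitable level were a proper product ab, minimality would give elements of
  levels \<open>a\<close> and \<open>b\<close> with nontrivial images. A conjugate of the second has
  image not commuting with that of the first, yet their commutator has level ab.\<close>

lemma congruence_kernel_prime:
  fixes G :: "('g, 'c) monoid_scheme"
  assumes G: "group G" and H: "subgroup H G" and \<rho>: "\<rho> \<in> hom G (GL_int n)"
    and k: "5 \<le> k" and f: "f \<in> epi (G\<lparr>carrier := H\<rparr>) (sym_group k)"
    and m: "0 < m" "\<And>h. h \<in> H \<Longrightarrow> mat_mod m (\<rho> h) = mat_mod m (1\<^sub>m n) \<Longrightarrow> f h = id"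
  shows "\<exists>p. prime p \<and> (\<forall>h\<in>H. mat_mod p (\<rho> h) = mat_mod p (1\<^sub>m n) \<longrightarrow> f h = id)"
proof -
  interpret G: group G by fact
  interpret H: subgroup H G by fact
  interpret Q: group "sym_group k" by (rule sym_group_is_group)
  let ?L = "G\<lparr>carrier := H\<rparr>"
  have fhom: "f \<in> hom ?L (sym_group k)" and fsurj: "f ` H = carrier (sym_group k)"
    using f by (simp_all add: epi_def)
  interpret f: group_hom ?L "sym_group k" f
    using G.subgroup_imp_group[OF H] fhom by (intro group_hom.intro group_hom_axioms.intro Q.is_group)
  have mult: "f (a \<otimes>\<^bsub>G\<^esub> b) = f a \<circ> f b" if "a \<in> H" "b \<in> H" for a b
    using f.hom_mult[of a b] that by (simp add: sym_group_mult)
  have perm: "f a permutes {1..k}" if "a \<in> H" for a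
    using f.hom_closed[of a] that by (simp add: sym_group_carrier)
  have finv: "f (inv\<^bsub>G\<^esub> a) = inv' (f a)" if "a \<in> H" for a
    using f.hom_inv[of a] that G.m_inv_consistent[OF H that] perm[OF that] by (simp add: sym_group_carrier)
  have \<rho>c: "\<rho> g \<in> carrier_mat n n" if "g \<in> carrier G" for g
    using hom_in_carrier[OF \<rho> that] by (auto simp: GL_int_def units_of_carrier Units_def ring_mat_simps)
  have \<rho>m: "\<rho> (g \<otimes>\<^bsub>G\<^esub> h) = \<rho> g * \<rho> h" if "g \<in> carrier G" "h \<in> carrier G" for g h
    using hom_mult[OF \<rho> that] by (simp add: GL_int_def units_of_mult ring_mat_simps)
  \<comment> \<open>Level 0 has to be excluded: reduction modulo 0 is the identity, so it would
    inherit the property from \<open>m\<close> and always be the least.\<close>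
  define good where "good l \<longleftrightarrow> 0 < l \<and> (\<forall>h\<in>H. mat_mod l (\<rho> h) = mat_mod l (1\<^sub>m n) \<longrightarrow> f h = id)" for l
  define l where "l = (LEAST l. good l)"
  have "good m" using m by (simp add: good_def)
  then have l: "good l" and least: "\<And>a. a < l \<Longrightarrow> \<not> good a"
    unfolding l_def by (auto intro: LeastI dest: not_less_Least)
  have l0: "0 < l" using l by (simp add: good_def)
  have trans: "Transposition.transpose 1 2 \<in> f ` H"
    unfolding fsurj sym_group_carrier using k by (intro permutes_swap_id) auto
  \<comment> \<open>Modulo 1 all matrices agree, which would make \<open>f\<close> trivial although
    its image contains a transposition.\<close>
  have "l \<noteq> 1"
  proof
    assume "l = 1"
    have "mat_mod 1 (\<rho> h) = mat_mod 1 (1\<^sub>m n)" if "h \<in> H" for h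
      using \<rho>c[OF H.mem_carrier[OF that]] by (intro eq_matI) (auto simp: mat_mod_def)
    then have "f h = id" if "h \<in> H" for h using that l \<open>l = 1\<close> by (simp add: good_def)
    then have "Transposition.transpose 1 (2::nat) = id" using trans by auto
    then show False by (simp add: transpose_eq_id_iff)
  qed
  then have l1: "1 < l" using l0 by simp
  have "prime l"
  proof (rule ccontr)
    assume "\<not> prime l"
    then obtain a where a: "a dvd l" "a \<noteq> 1" "a \<noteq> l" using l1 by (auto simp: prime_nat_iff)
    then obtain b where b: "l = a * b" by (elim dvdE)
    have "a \<noteq> 0" "b \<noteq> 0" "b \<noteq> 1" using a b l0 by auto
    then have ab: "l = a * b" "1 < a" "a < l" "1 < b" "b < l" using a(2) b by auto
    obtain x where x: "x \<in> H" "mat_mod a (\<rho> x) = mat_mod a (1\<^sub>m n)" "f x \<noteq> id"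
      using least[OF ab(3)] ab(2) by (auto simp: good_def)
    obtain y where y: "y \<in> H" "mat_mod b (\<rho> y) = mat_mod b (1\<^sub>m n)" "f y \<noteq> id"
      using least[OF ab(5)] ab(4) by (auto simp: good_def)
    obtain g where g: "g permutes {1..k}" "f x \<circ> (g \<circ> f y \<circ> inv' g) \<noteq> (g \<circ> f y \<circ> inv' g) \<circ> f x"
      using noncommuting_conjugate[of "{1..k}" "f x" "f y"] k perm x y by auto
    \<comment> \<open>Surjectivity lifts \<open>g\<close> to \<open>u\<close> in \<open>H\<close>;
      conjugating by \<open>u\<close> preserves level \<open>b\<close>, the kernel of reduction
      being normal.\<close>
    have "g \<in> f ` H" unfolding fsurj sym_group_carrier by (rule g(1))
    then obtain u where u: "u \<in> H" "g = f u" by blast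
    let ?y = "u \<otimes>\<^bsub>G\<^esub> y \<otimes>\<^bsub>G\<^esub> inv\<^bsub>G\<^esub> u"
    have yH: "?y \<in> H" using u y by simp
    have fy: "f ?y = g \<circ> f y \<circ> inv' g" using u y(1) by (simp add: mult finv)
    have grp: "group_hom G (GL_mod n c) (mat_mod c \<circ> \<rho>)" if "0 < c" for c
      using hom_compose[OF \<rho> mat_mod_hom[OF that]] group_GL_mod[OF that]
      by (intro group_hom.intro group_hom_axioms.intro G.is_group)
    interpret B: group_hom G "GL_mod n b" "mat_mod b \<circ> \<rho>" using grp ab(4) by simp
    have "(mat_mod b \<circ> \<rho>) y = \<one>\<^bsub>GL_mod n b\<^esub>" using y(2) by (simp add: GL_mod_simps)
    then have "(mat_mod b \<circ> \<rho>) ?y = \<one>\<^bsub>GL_mod n b\<^esub>"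
      using u(1) y(1) B.hom_mult B.hom_inv B.hom_closed B.H.r_inv B.H.r_one
      by (simp del: o_apply)
    then have cy: "mat_mod b (\<rho> ?y) = mat_mod b (1\<^sub>m n)" by (simp add: GL_mod_simps)
    interpret L: group_hom G "GL_mod n l" "mat_mod l \<circ> \<rho>" using grp l0 by simp
    have xc: "x \<in> carrier G" "?y \<in> carrier G" using x(1) yH by (simp_all only: H.mem_carrier)
    have "mat_mod l (\<rho> x * \<rho> ?y) = mat_mod l (\<rho> ?y * \<rho> x)"
      unfolding ab(1) by (rule congruent_one_commute[OF \<rho>c[OF xc(1)] x(2) \<rho>c[OF xc(2)] cy])
    then have "(mat_mod l \<circ> \<rho>) (x \<otimes>\<^bsub>G\<^esub> ?y) = (mat_mod l \<circ> \<rho>) (?y \<otimes>\<^bsub>G\<^esub> x)"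
      using \<rho>m[OF xc] \<rho>m[OF xc(2,1)] by simp
    then have "(mat_mod l \<circ> \<rho>) ((x \<otimes>\<^bsub>G\<^esub> ?y) \<otimes>\<^bsub>G\<^esub> inv\<^bsub>G\<^esub> (?y \<otimes>\<^bsub>G\<^esub> x)) = \<one>\<^bsub>GL_mod n l\<^esub>"
      using xc L.hom_mult[of "x \<otimes>\<^bsub>G\<^esub> ?y" "inv\<^bsub>G\<^esub> (?y \<otimes>\<^bsub>G\<^esub> x)"] L.hom_inv[of "?y \<otimes>\<^bsub>G\<^esub> x"]
        L.hom_closed[of "?y \<otimes>\<^bsub>G\<^esub> x"] L.H.r_inv[of "(mat_mod l \<circ> \<rho>) (?y \<otimes>\<^bsub>G\<^esub> x)"]
      by (simp only: G.m_closed G.inv_closed)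
    moreover have H1: "x \<otimes>\<^bsub>G\<^esub> ?y \<in> H" and H2: "?y \<otimes>\<^bsub>G\<^esub> x \<in> H" using x(1) yH by (simp_all only: H.m_closed)
    ultimately have "f ((x \<otimes>\<^bsub>G\<^esub> ?y) \<otimes>\<^bsub>G\<^esub> inv\<^bsub>G\<^esub> (?y \<otimes>\<^bsub>G\<^esub> x)) = id"
      using l H.m_closed[OF H1 H.m_inv_closed[OF H2]] unfolding good_def GL_mod_simps o_apply by blast
    then have "f (x \<otimes>\<^bsub>G\<^esub> ?y) \<circ> inv' (f (?y \<otimes>\<^bsub>G\<^esub> x)) = id"
      using mult[OF H1 H.m_inv_closed[OF H2]] finv[OF H2] by simp
    then have "f (x \<otimes>\<^bsub>G\<^esub> ?y) \<circ> (inv' (f (?y \<otimes>\<^bsub>G\<^esub> x)) \<circ> f (?y \<otimes>\<^bsub>G\<^esub> x)) = f (?y \<otimes>\<^bsub>G\<^esub> x)"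
      unfolding o_assoc by simp
    then have "f (x \<otimes>\<^bsub>G\<^esub> ?y) = f (?y \<otimes>\<^bsub>G\<^esub> x)" by (simp add: permutes_inv_o(2)[OF perm[OF H2]])
    then have "f x \<circ> f ?y = f ?y \<circ> f x" using mult[OF x(1) yH] mult[OF yH x(1)] by simp
    then show False using g(2) unfolding fy by blast
  qed
  then show ?thesis using l by (auto simp: good_def)
qed

theorem proposition3p2:
  fixes G :: "('g, 'c) monoid_scheme" and F :: "('f, 'd) monoid_scheme"
    and H :: "'g set" and \<phi> :: "'g \<Rightarrow> 'f"
  assumes "group G"
    and "finite_index_subgroup H G"
    and "is_free_group F" and "\<not> comm_group F"
    and "\<phi> \<in> epi (G\<lparr>carrier := H\<rparr>) F"
  shows "\<forall>n. \<forall>\<rho> \<in> hom G (GL_int n). \<not> congruence_subgroup_property G n \<rho>"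
proof (intro allI ballI notI)
  fix n \<rho> assume \<rho>: "\<rho> \<in> hom G (GL_int n)" and csp: "congruence_subgroup_property G n \<rho>"
  let ?L = "G\<lparr>carrier := H\<rparr>"
  have H: "subgroup H G" using assms(2) by (simp add: finite_index_subgroup_def)
  interpret G: group G by fact
  interpret H: subgroup H G by fact
  have L: "group ?L" using G.subgroup_imp_group[OF H] .
  \<comment> \<open>\<open>k\<close> must be fixed before the congruence property yields
    \<open>p\<close>, so two primes above \<open>n * n\<close> are kept in reserve. The summand 2
    makes both at least 3, whence \<open>k\<close> is at least 9.\<close>
  obtain r1 :: nat where r1: "prime r1" "n * n + 2 < r1" using bigger_prime by blast
  obtain r2 :: nat where r2: "prime r2" "r1 < r2" using bigger_prime by blast
  define k where "k = r2 * r2"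
  have kr: "r1 * r1 \<le> k" "r2 * r2 \<le> k" unfolding k_def using r2(2) by (auto intro: mult_le_mono)
  have "3 * 3 \<le> r2 * r2" using r1(2) r2(2) by (intro mult_le_mono) auto
  then have k5: "5 \<le> k" by (simp add: k_def)
  let ?Q = "sym_group k"
  interpret Q: group ?Q by (rule sym_group_is_group)
  have gens: "Transposition.transpose 1 2 \<in> carrier ?Q" "full_cycle k \<in> carrier ?Q"
    unfolding sym_group_carrier using k5 full_cycle_permutes[of k] by (auto intro!: permutes_swap_id)
  obtain \<psi> where \<psi>: "\<psi> \<in> hom F ?Q" "Transposition.transpose 1 2 \<in> \<psi> ` carrier F" "full_cycle k \<in> \<psi> ` carrier F"
    using nonabelian_free_group_hom[OF assms(3,4) Q.is_group gens] by blast
  interpret \<psi>: group_hom F ?Q \<psi>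
    using assms(3) \<psi>(1) by (intro group_hom.intro group_hom_axioms.intro Q.is_group) (simp add: is_free_group_def)
  have onto: "\<psi> ` carrier F = carrier ?Q"
    using sym_group_two_generators[OF _ \<psi>.img_is_subgroup \<psi>(2,3)] k5 by simp
  define f where "f = \<psi> \<circ> \<phi>"
  have \<phi>: "\<phi> \<in> hom ?L F" "\<phi> ` H = carrier F" using assms(5) by (simp_all add: epi_def)
  have fhom: "f \<in> hom ?L ?Q" unfolding f_def by (rule hom_compose[OF \<phi>(1) \<psi>(1)])
  have fonto: "f ` H = carrier ?Q" unfolding f_def image_comp[symmetric] \<phi>(2) by (rule onto)
  have fepi: "f \<in> epi ?L ?Q" using fhom fonto by (simp add: epi_def)
  have finQ: "finite (carrier ?Q)" by (simp add: sym_group_def finite_permutations)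
  \<comment> \<open>The kernel of \<open>f\<close> is the finite index subgroup that will contain no
    congruence subgroup.\<close>
  have "finite_index_subgroup {h \<in> H. f h = \<one>\<^bsub>?Q\<^esub>} G"
    by (rule finite_index_kernel[OF assms(1,2) Q.is_group finQ fhom])
  then obtain m where m: "2 \<le> m" "principal_congruence_subgroup G n \<rho> m \<subseteq> {h \<in> H. f h = \<one>\<^bsub>?Q\<^esub>}"
    using csp unfolding congruence_subgroup_property_def by blast
  have "f h = id" if "h \<in> H" "mat_mod m (\<rho> h) = mat_mod m (1\<^sub>m n)" for h
  proof -
    have "h \<in> principal_congruence_subgroup G n \<rho> m"
      using that by (simp add: principal_congruence_subgroup_def kernel_def GL_mod_simps)
    then show ?thesis using m(2) by (auto simp: sym_group_one)
  qed
  then obtain p where p: "prime p" "\<And>h. h \<in> H \<Longrightarrow> mat_mod p (\<rho> h) = mat_mod p (1\<^sub>m n) \<Longrightarrow> f h = id"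
    using congruence_kernel_prime[OF assms(1) H \<rho> k5 fepi, of m] m(1) by auto
  \<comment> \<open>At most one of the two reserved primes equals \<open>p\<close>, and
    \<open>k\<close> has room for the Heisenberg group of either.\<close>
  have "\<exists>r. prime r \<and> r \<noteq> p \<and> n * n < r \<and> r * r \<le> k"
  proof (cases "p = r1")
    case True
    then show ?thesis using r1 r2 kr by (intro exI[of _ r2]) auto
  next
    case False
    then show ?thesis using r1 kr by (intro exI[of _ r1]) auto
  qed
  then obtain r where r: "prime r" "r \<noteq> p" "n * n < r" "r * r \<le> k" by blast
  obtain R u v where R: "subgroup R ?Q" "card R = r ^ 3" "u \<in> R" "v \<in> R" "u \<circ> v \<noteq> v \<circ> u"
    using sym_group_heisenberg_subgroup[OF prime_ge_2_nat[OF r(1)] r(4)] by blast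
  have p0: "0 < p" using p(1) prime_gt_0_nat by blast
  have \<alpha>: "mat_mod p \<circ> \<rho> \<in> hom ?L (GL_mod n p)"
    using hom_compose[OF \<rho> mat_mod_hom[OF p0]] H.subset by (auto simp: hom_def)
  obtain x y z e where xyz: "x \<in> carrier (GL_mod n p)" "y \<in> carrier (GL_mod n p)" "z \<in> carrier (GL_mod n p)"
    "z \<noteq> \<one>\<^bsub>GL_mod n p\<^esub>" "y \<otimes>\<^bsub>GL_mod n p\<^esub> x = z \<otimes>\<^bsub>GL_mod n p\<^esub> x \<otimes>\<^bsub>GL_mod n p\<^esub> y"
    "z \<otimes>\<^bsub>GL_mod n p\<^esub> x = x \<otimes>\<^bsub>GL_mod n p\<^esub> z" "z \<otimes>\<^bsub>GL_mod n p\<^esub> y = y \<otimes>\<^bsub>GL_mod n p\<^esub> z"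
    "z [^]\<^bsub>GL_mod n p\<^esub> (r ^ e) = \<one>\<^bsub>GL_mod n p\<^esub>"
  proof -
    have "\<exists>x \<in> carrier (GL_mod n p). \<exists>y \<in> carrier (GL_mod n p). \<exists>z \<in> carrier (GL_mod n p). \<exists>e.
      z \<noteq> \<one>\<^bsub>GL_mod n p\<^esub> \<and> y \<otimes>\<^bsub>GL_mod n p\<^esub> x = z \<otimes>\<^bsub>GL_mod n p\<^esub> x \<otimes>\<^bsub>GL_mod n p\<^esub> y \<and>
      z \<otimes>\<^bsub>GL_mod n p\<^esub> x = x \<otimes>\<^bsub>GL_mod n p\<^esub> z \<and> z \<otimes>\<^bsub>GL_mod n p\<^esub> y = y \<otimes>\<^bsub>GL_mod n p\<^esub> z \<and>
      z [^]\<^bsub>GL_mod n p\<^esub> (r ^ e) = \<one>\<^bsub>GL_mod n p\<^esub>"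
    proof (rule section_central_commutator[OF L group_GL_mod[OF p0] Q.is_group finite_GL_mod finQ \<alpha> fhom
            _ R(1) _ R(2) r(1) R(3,4)])
      fix h assume "h \<in> carrier ?L" "(mat_mod p \<circ> \<rho>) h = \<one>\<^bsub>GL_mod n p\<^esub>"
      then show "f h = \<one>\<^bsub>?Q\<^esub>" using p(2)[of h] by (simp add: GL_mod_simps sym_group_one)
    next
      show "R \<subseteq> f ` carrier ?L" using subgroup.subset[OF R(1)] fonto by simp
      show "u \<otimes>\<^bsub>?Q\<^esub> v \<noteq> v \<otimes>\<^bsub>?Q\<^esub> u" using R(5) by (simp add: sym_group_mult)
    qed
    then show ?thesis by (elim bexE exE conjE) (rule that)
  qed
  show False
    using GL_mod_central_commutator_trivial[OF p(1) r(1-3) xyz(1-3) xyz(5-8)] xyz(4) by blast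
qed

end
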